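(* Let $d\in\mathbf{N}$. If $\alpha_{\Delta^d}<\infty$, then $\mathcal{P}_\Delta^=(\mathbf{S}^d)\subseteq\operatorname{argmax}_{\mathcal{P}(\mathbf{S}^d)}E_{\alpha_{\Delta^d}}$, and the inclusion is strict.
   Context: $\mathbf{N}=\{1,2,\ldots\}$. $\mathbf{S}^d=\{x\in\mathbf{R}^{d+1}: |x|=1\}$ with geodesic distance $\rho(x,y)=\arccos(x\cdot y)$; $\mathcal{P}(\mathbf{S}^d)$ is the set of Borel probability measures on $\mathbf{S}^d$. Put $\Lambda(x,y)=\frac{2}{\pi}\min\{\rho(x,y),\pi-\rho(x,y)\}$. For exponents $\alpha\in(0,\infty]$ set $E_\alpha(\mu)=\frac12\iint\Lambda^\alpha(x,y)\,d\mu(x)\,d\mu(y)$, where $\Lambda^\infty(x,y)=1$ if $x\cdot y=0$ and $0$ otherwise. $\mathcal{P}_\Delta^=(\mathbf{S}^d)$ is the set of $\mu\in\mathcal{P}(\mathbf{S}^d)$ for which there is an orthonormal basis $\{v_0,\ldots,v_d\}$ of $\mathbf{R}^{d+1}$ with $\mu(\{v_i,-v_i\})=\frac{1}{d+1}$ for every $i=0,\ldots,d$. $\operatorname{argmax}_{\mathcal{P}(\mathbf{S}^d)}E_\alpha$ is the set of all maximizers of $E_\alpha$ over $\mathcal{P}(\mathbf{S}^d)$. The threshold exponent $\alpha_{\Delta^d}$ is the unique element of $[1,\infty]$ such that $0<\alpha<\alpha_{\Delta^d}$ implies $\mathcal{P}_\Delta^=(\mathbf{S}^d)\cap\operatorname{argmax}_{\mathcal{P}(\mathbf{S}^d)}E_\alpha=\emptyset$,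 while $\alpha>\alpha_{\Delta^d}$ implies $\mathcal{P}_\Delta^=(\mathbf{S}^d)=\operatorname{argmax}_{\mathcal{P}(\mathbf{S}^d)}E_\alpha$ (existence and uniqueness of such an exponent hold). *)

theory Defs
  imports "HOL-Probability.Probability"
begin

text \<open>
  Throughout, the sphere \<open>S\<^sup>d\<close> is \<^term>\<open>sphere 0 1\<close> in \<open>real ^ 'n\<close> with \<open>CARD('n) = d + 1\<close>.
\<close>

definition geodesic_dist :: "real ^ 'n::finite \<Rightarrow> real ^ 'n \<Rightarrow> real" where
  "geodesic_dist x y = arccos (x \<bullet> y)"

definition Lam :: "real ^ 'n::finite \<Rightarrow> real ^ 'n \<Rightarrow> real" where
  "Lam x y = 2 / pi * min (geodesic_dist x y) (pi - geodesic_dist x y)"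

text \<open>
  The power \<open>\<Lambda>\<^sup>\<alpha>\<close>; exponents are extended reals, and only \<open>0 < \<alpha> \<le> \<infinity>\<close> is meaningful.
  For such \<open>\<alpha>\<close>, the convention \<open>0 powr \<alpha> = 0\<close> gives the expected value where \<^const>\<open>Lam\<close> vanishes.
\<close>

definition Lam_pow :: "ereal \<Rightarrow> real ^ 'n::finite \<Rightarrow> real ^ 'n \<Rightarrow> real" where
  "Lam_pow \<alpha> x y =
     (if \<alpha> = \<infinity> then (if x \<bullet> y = 0 then 1 else 0)
      else Lam x y powr real_of_ereal \<alpha>)"

definition sphere_probs :: "(real ^ 'n::finite) measure set" where
  "sphere_probs = {\<mu>. prob_space \<mu> \<and> sets \<mu> = sets (restrict_space borel (sphere 0 1))}"

definition energy :: "ereal \<Rightarrow> (real ^ 'n::finite) measure \<Rightarrow> real" where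
  "energy \<alpha> \<mu> = 1 / 2 * (LINT x|\<mu>. LINT y|\<mu>. Lam_pow \<alpha> x y)"

definition energy_argmax :: "ereal \<Rightarrow> (real ^ 'n::finite) measure set" where
  "energy_argmax \<alpha> = {\<mu>. is_arg_max (energy \<alpha>) (\<lambda>\<nu>. \<nu> \<in> sphere_probs) \<mu>}"

definition orthonormal_basis :: "(real ^ 'n::finite) set \<Rightarrow> bool" where
  "orthonormal_basis B \<longleftrightarrow>
     pairwise orthogonal B \<and> (\<forall>v\<in>B. norm v = 1) \<and> independent B \<and> span B = UNIV"

definition P_Delta_eq :: "(real ^ 'n::finite) measure set" where
  "P_Delta_eq = {\<mu> \<in> sphere_probs.
     \<exists>B. orthonormal_basis B \<and> (\<forall>v\<in>B. measure \<mu> {v, - v} = 1 / real CARD('n))}"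

definition is_threshold_exponent :: "'n::finite itself \<Rightarrow> ereal \<Rightarrow> bool" where
  "is_threshold_exponent _ a \<longleftrightarrow> 1 \<le> a \<and>
     (\<forall>\<alpha>. 0 < \<alpha> \<and> \<alpha> < a \<longrightarrow> (P_Delta_eq :: (real ^ 'n) measure set) \<inter> energy_argmax \<alpha> = {}) \<and>
     (\<forall>\<alpha>. a < \<alpha> \<longrightarrow> (P_Delta_eq :: (real ^ 'n) measure set) = energy_argmax \<alpha>)"

definition threshold_exponent :: "'n::finite itself \<Rightarrow> ereal" where
  "threshold_exponent T = (THE a. is_threshold_exponent T a)"

end

theory Submission
  imports Defs
begin

text \<open>
  Every measure in \<open>P_Delta_eq\<close> has energy \<open>D / 2\<close> with \<open>D = d / (d + 1)\<close>, whatever the exponent, and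
  the energy decreases in the exponent. So the threshold is the infimum \<open>a\<close> of the exponents at
  which \<open>D / 2\<close> bounds the energy, and by dominated convergence the bound persists at \<open>a\<close>. Beyond
  \<open>a\<close>, a maximizer has the same energy for two exponents, so almost all pairs of its points are
  parallel or orthogonal.

  For strictness, if \<open>a = 1\<close> a mixture of two bases is another maximizer. If \<open>a > 1\<close>, take measures with
  energy above \<open>D / 2\<close> for exponents increasing to \<open>a\<close>; a weak limit \<open>\<mu>\<close> of these maximizes the energy
  at \<open>a\<close>. It is not in \<open>P_Delta_eq\<close>, since for exponents bounded away from 1 no measure weakly close
  to \<open>P_Delta_eq\<close> has energy above \<open>D / 2\<close>: away from the axes the potential is strictly smaller than
  \<open>D\<close>, and near an axis spreading the mass over a distance \<open>r\<close> gains order \<open>r powr \<alpha>\<close> but loses order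
  \<open>r\<close> in the interaction with the other axes. Weak limits are realised as almost sure limits of
  random variables by Helly's and Skorohod's theorems on the line, transported to the sphere along
  a space-filling curve.
\<close>

section \<open>The interaction kernel\<close>

text \<open>A competitor may smear all the axes at once, so the loss of interaction cannot be
  measured against the axes themselves; it is measured against points of the other cells, chosen by
  averaging. The difference of two points near one axis is almost orthogonal to that axis, hence the
  other cells see it to first order. Comparing this loss with \<open>clam x y powr a\<close> leaves
  a factor \<open>clam x y powr (a - 1)\<close>, at most
  \<open>(2 * \<epsilon>) powr (a - 1)\<close> in a cell of radius \<epsilon>, which has to absorb
  the constant \<open>4 * pi * N\<close> with N the dimension of the space. Shrinking \<epsilon>
  achieves this only for a > 1, and the radius obtained tends to 0 as the exponent tends to 1. So
  the estimate is run with a fixed lower exponent, midway between 1 and the threshold, and exponent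
  1 needs a witness of its own. The angle of 45 degrees comes from there: the kernel has base value
  1/2 at that angle, and the energy of the mixture differs from the common value by a positive
  multiple of \<open>2 powr (1 - \<alpha>) - 1\<close>. This changes sign exactly at 1, so one
  family gives both the lower bound 1 on the threshold and strictness at 1.\<close>

text \<open>On the unit sphere this is \<^const>\<open>Lam\<close>; clipping the inner product at 1 makes it continuous
  on the whole space.\<close>

definition clam :: "real ^ 'n::finite \<Rightarrow> real ^ 'n \<Rightarrow> real" where
  "clam x y = 1 - 2 / pi * arcsin (min 1 \<bar>x \<bullet> y\<bar>)"

definition kpow :: "ereal \<Rightarrow> real ^ 'n::finite \<Rightarrow> real ^ 'n \<Rightarrow> real" where
  "kpow \<alpha> x y = (if \<alpha> = \<infinity> then (if x \<bullet> y = 0 then 1 else 0)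
      else clam x y powr real_of_ereal \<alpha>)"

lemma abs_inner_unit_le:
  fixes x y :: "'a::real_inner"
  assumes "norm x = 1" "norm y = 1"
  shows "\<bar>x \<bullet> y\<bar> \<le> 1"
  using Cauchy_Schwarz_ineq2[of x y] assms by simp

text \<open>Folding the angle at a right angle amounts to taking the absolute value of the inner
  product, because arccos and arcsin add up to pi / 2.\<close>

lemma Lam_eq_clam:
  assumes "norm x = 1" "norm y = 1"
  shows "Lam x y = clam x y"
proof -
  define t where "t = x \<bullet> y"
  have t: "\<bar>t\<bar> \<le> 1" using abs_inner_unit_le assms t_def by auto
  have "min (arccos t) (pi - arccos t) = pi / 2 - arcsin \<bar>t\<bar>"
  proof (cases "t \<ge> 0")
    case True
    then show ?thesis using t arccos_arcsin_eq[of t] arccos_le_pi2[of t] by auto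
  next
    case False
    then show ?thesis
      using t arccos_arcsin_eq[of "-t"] arccos_le_pi2[of "-t"] arccos_minus[of "-t"] by auto
  qed
  then show ?thesis
    using t unfolding Lam_def geodesic_dist_def clam_def t_def[symmetric]
    by (simp add: field_simps min_absorb2)
qed

lemma clam_bounds: "0 \<le> clam x y" "clam x y \<le> 1"
  using arcsin_nonneg[of "min 1 \<bar>x \<bullet> y\<bar>"] arcsin_ubound[of "min 1 \<bar>x \<bullet> y\<bar>"]
  by (auto simp: clam_def field_simps)

lemma clam_commute: "clam x y = clam y x"
  by (simp add: clam_def inner_commute)

lemma clam_minus_right [simp]: "clam x (- y) = clam x y"
  by (simp add: clam_def)

lemma clam_eq_1_iff: "clam x y = 1 \<longleftrightarrow> x \<bullet> y = 0"
proof -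
  have "arcsin (min 1 \<bar>x \<bullet> y\<bar>) = 0 \<longleftrightarrow> arcsin (min 1 \<bar>x \<bullet> y\<bar>) = arcsin 0" by simp
  also have "\<dots> \<longleftrightarrow> x \<bullet> y = 0"
    by (subst arcsin_eq_iff) (auto simp: min_def)
  finally show ?thesis by (simp add: clam_def)
qed

lemma clam_eq_0_iff: "clam x y = 0 \<longleftrightarrow> \<bar>x \<bullet> y\<bar> \<ge> 1"
proof -
  have "clam x y = 0 \<longleftrightarrow> arcsin (min 1 \<bar>x \<bullet> y\<bar>) = arcsin 1"
    by (auto simp: clam_def field_simps)
  also have "\<dots> \<longleftrightarrow> min 1 \<bar>x \<bullet> y\<bar> = 1"
    by (subst arcsin_eq_iff) (auto simp: min_def)
  finally show ?thesis by auto
qed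

lemma continuous_on_clam:
  fixes f g :: "'a::topological_space \<Rightarrow> real ^ 'n::finite"
  assumes "continuous_on A f" "continuous_on A g"
  shows "continuous_on A (\<lambda>z. clam (f z) (g z))"
  unfolding clam_def
  by (intro continuous_intros assms) (auto simp: min_def)

lemma tendsto_clam:
  assumes "(f \<longlongrightarrow> x) F" "(g \<longlongrightarrow> y) F"
  shows "((\<lambda>z. clam (f z) (g z)) \<longlongrightarrow> clam x y) F"
proof -
  have "continuous_on UNIV (\<lambda>p. clam (fst p) (snd p :: real ^ 'n))"
    by (intro continuous_on_clam continuous_intros)
  then have "isCont (\<lambda>p. clam (fst p) (snd p)) (x, y)"
    unfolding continuous_on_eq_continuous_at[OF open_UNIV] by blast
  from isCont_tendsto_compose[OF this tendsto_Pair[OF assms]] show ?thesis by simp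
qed

lemma borel_measurable_clam [measurable (raw)]:
  assumes [measurable]: "f \<in> borel_measurable M" "g \<in> borel_measurable M"
  shows "(\<lambda>z. clam (f z) (g z)) \<in> borel_measurable M"
proof -
  have "continuous_on UNIV (\<lambda>p. clam (fst p) (snd p :: real ^ 'n))"
    by (intro continuous_on_clam continuous_intros)
  from borel_measurable_continuous_onI[OF this]
  have "(\<lambda>p. clam (fst p) (snd p :: real ^ 'n)) \<in> borel_measurable (borel \<Otimes>\<^sub>M borel)"
    by (simp add: borel_prod)
  from measurable_compose[OF _ this, of "\<lambda>z. (f z, g z)" M] show ?thesis by simp
qed

lemma borel_measurable_kpow [measurable (raw)]:
  assumes [measurable]: "f \<in> borel_measurable M" "g \<in> borel_measurable M"
  shows "(\<lambda>z. kpow \<alpha> (f z) (g z)) \<in> borel_measurable M"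
  unfolding kpow_def by measurable

lemma kpow_commute: "kpow \<alpha> x y = kpow \<alpha> y x"
  by (simp add: kpow_def inner_commute clam_commute)

lemma kpow_nonneg: "0 \<le> kpow \<alpha> x y"
  by (simp add: kpow_def)

lemma kpow_le_1:
  assumes "0 < \<alpha>"
  shows "kpow \<alpha> x y \<le> 1"
proof (cases "\<alpha> = \<infinity>")
  case False
  then have "real_of_ereal \<alpha> \<ge> 0" using assms by (cases \<alpha>) auto
  then show ?thesis using clam_bounds[of x y] False by (auto simp: kpow_def intro!: powr_le1)
qed (simp add: kpow_def)

lemma kpow_orthogonal: "x \<bullet> y = 0 \<Longrightarrow> kpow \<alpha> x y = 1"
  using clam_eq_1_iff[of x y] by (auto simp: kpow_def)

lemma kpow_parallel: "\<bar>x \<bullet> y\<bar> \<ge> 1 \<Longrightarrow> kpow \<alpha> x y = 0"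
  using clam_eq_0_iff[of x y] by (auto simp: kpow_def)

lemma kpow_antimono:
  assumes "0 < \<alpha>" "\<alpha> \<le> \<beta>"
  shows "kpow \<beta> x y \<le> kpow \<alpha> x y"
proof (cases "\<beta> = \<infinity>")
  case True
  then show ?thesis
    using kpow_nonneg[of \<alpha> x y] kpow_orthogonal[of x y \<alpha>] by (simp add: kpow_def[of \<infinity>])
next
  case False
  then have "\<alpha> \<noteq> \<infinity>" using assms by auto
  have "real_of_ereal \<alpha> \<le> real_of_ereal \<beta>" using assms False by (cases \<alpha>; cases \<beta>) auto
  then have "clam x y powr real_of_ereal \<beta> \<le> clam x y powr real_of_ereal \<alpha>"
    using clam_bounds[of x y] by (cases "clam x y = 0") (auto intro!: powr_mono')
  then show ?thesis using False \<open>\<alpha> \<noteq> \<infinity>\<close> by (simp add: kpow_def)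
qed

text \<open>A power decreases strictly in the exponent when its base lies strictly between 0 and 1.
  Equal energies at two exponents therefore leave only parallel and orthogonal pairs.\<close>

lemma kpow_strict_antimono:
  assumes "0 < \<alpha>" "\<alpha> < \<beta>" "x \<bullet> y \<noteq> 0" "\<bar>x \<bullet> y\<bar> < 1"
  shows "kpow \<beta> x y < kpow \<alpha> x y"
proof -
  have c: "0 < clam x y" "clam x y < 1"
    using clam_bounds[of x y] clam_eq_0_iff[of x y] clam_eq_1_iff[of x y] assms(3,4) by linarith+
  have "\<alpha> \<noteq> \<infinity>" using assms by auto
  show ?thesis
  proof (cases "\<beta> = \<infinity>")
    case True
    then show ?thesis using c assms \<open>\<alpha> \<noteq> \<infinity>\<close> by (simp add: kpow_def)
  next
    case False
    have "real_of_ereal \<alpha> < real_of_ereal \<beta>" using assms False by (cases \<alpha>; cases \<beta>) auto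
    then have "clam x y powr real_of_ereal \<beta> < clam x y powr real_of_ereal \<alpha>"
      using c by (intro powr_less_mono') auto
    then show ?thesis using False \<open>\<alpha> \<noteq> \<infinity>\<close> by (simp add: kpow_def)
  qed
qed

section \<open>Linear comparison of the kernel with chords and inner products\<close>

lemma Jordan_sin_ge:
  assumes "0 \<le> u" "u \<le> pi / 2"
  shows "2 / pi * u \<le> sin u"
proof -
  \<comment> \<open>Sine is concave here, so its graph lies above the chord from 0 to pi / 2, of
    slope 2 / pi.\<close>
  have cvx: "convex_on {0..pi/2} (\<lambda>x. - sin x)"
    by (rule f''_ge0_imp_convex[where f' = "\<lambda>x. - cos x" and f'' = sin])
      (auto intro!: derivative_eq_intros sin_ge_zero)
  define t where "t = 2 / pi * u"
  have "- sin ((1 - t) *\<^sub>R 0 + t *\<^sub>R (pi/2)) \<le> (1 - t) * (- sin 0) + t * (- sin (pi/2))"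
    by (rule convex_onD[OF cvx]) (use assms in \<open>auto simp: t_def field_simps\<close>)
  then show ?thesis by (simp add: t_def)
qed

text \<open>The chord is \<open>2 * sin (\<theta> / 2)\<close>, which is at least
  \<open>2 / pi * \<theta>\<close> by Jordan's inequality. This bounds the interaction inside a cell
  by a distance.\<close>

lemma clam_le_dist:
  assumes "norm x = 1" "norm y = 1"
  shows "clam x y \<le> norm (x - y)"
proof -
  define \<theta> where "\<theta> = arccos (x \<bullet> y)"
  have t: "\<bar>x \<bullet> y\<bar> \<le> 1" using abs_inner_unit_le assms by auto
  have th: "0 \<le> \<theta>" "\<theta> \<le> pi" "cos \<theta> = x \<bullet> y"
    using t by (auto simp: \<theta>_def arccos_lbound arccos_ubound)
  have "(norm (x - y))\<^sup>2 = 2 - 2 * cos \<theta>"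
    using assms th by (simp add: power2_norm_eq_inner inner_diff inner_commute norm_eq_1)
  also have "\<dots> = (2 * sin (\<theta> / 2))\<^sup>2"
    using cos_double_sin[of "\<theta>/2"] by (simp add: power2_eq_square)
  finally have "norm (x - y) = 2 * sin (\<theta> / 2)"
    by (rule power2_eq_imp_eq) (use th in \<open>auto simp: sin_ge_zero\<close>)
  moreover have "clam x y \<le> 2 / pi * \<theta>"
    unfolding Lam_eq_clam[OF assms, symmetric] Lam_def geodesic_dist_def \<theta>_def
    by (intro mult_left_mono) auto
  ultimately show ?thesis using Jordan_sin_ge[of "\<theta>/2"] th by simp
qed

text \<open>Follows from sin u \<le> u. It bounds the deviation from orthogonality by the
  interaction that is lost.\<close>

lemma abs_inner_le_clam:
  assumes "norm x = 1" "norm y = 1"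
  shows "\<bar>x \<bullet> y\<bar> \<le> pi / 2 * (1 - clam x y)"
proof -
  have t: "\<bar>x \<bullet> y\<bar> \<le> 1" using abs_inner_unit_le assms by auto
  have "\<bar>x \<bullet> y\<bar> = sin (arcsin \<bar>x \<bullet> y\<bar>)" using t by simp
  also have "\<dots> \<le> arcsin \<bar>x \<bullet> y\<bar>" using t arcsin_nonneg[of "\<bar>x \<bullet> y\<bar>"] by (intro sin_x_le_x) auto
  also have "\<dots> = pi / 2 * (1 - clam x y)" using t by (simp add: clam_def min_absorb2)
  finally show ?thesis .
qed

section \<open>Weak compactness on the sphere\<close>

text \<open>Schoenberg's space-filling curve: the continuous function \<open>zigzag\<close> reads off the ternary digit
  0 or 2 of a Cantor number, so distributing binary digits of coordinates over ternary digits
  gives an explicit Borel section.\<close>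

definition zigzag :: "real \<Rightarrow> real" where
  "zigzag t = max 0 (min 1 (1 / 2 - cos (pi * t)))"

lemma zigzag_bounds: "0 \<le> zigzag t" "zigzag t \<le> 1"
  by (auto simp: zigzag_def)

lemma cos_pi_even_plus: "cos (pi * (2 * real m + t)) = cos (pi * t)"
  using cos_add[of "2 * real m * pi" "pi * t"] cos_2npi[of m] sin_2npi[of m]
  by (simp add: algebra_simps)

text \<open>The shift 1/2 in \<open>zigzag\<close> is cos (pi / 3): on the first third of the unit
  interval the cosine is at least 1/2, so clipping gives exactly 0. The last third is the mirror
  image.\<close>

lemma zigzag_eq_0:
  assumes "0 \<le> t" "t \<le> 1 / 3"
  shows "zigzag (2 * real m + t) = 0"
proof -
  have "cos (pi / 3) \<le> cos (pi * t)"
    using assms by (intro cos_monotone_0_pi_le) (auto simp: field_simps)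
  then show ?thesis by (simp add: zigzag_def cos_pi_even_plus cos_60)
qed

lemma zigzag_eq_1:
  assumes "2 / 3 \<le> t" "t \<le> 1"
  shows "zigzag (2 * real m + t) = 1"
proof -
  have "cos (pi * t) \<le> cos (pi - pi / 3)"
    using assms by (intro cos_monotone_0_pi_le) (auto simp: field_simps)
  then have "cos (pi * t) \<le> - (1 / 2)" by (simp only: cos_pi_minus cos_60)
  then show ?thesis by (simp add: zigzag_def cos_pi_even_plus)
qed

text \<open>For b with values 0 and 1 this is the point of the Cantor set whose ternary digits are
  \<open>2 * b j\<close>.\<close>

definition cantor_sum :: "(nat \<Rightarrow> real) \<Rightarrow> real" where
  "cantor_sum b = (\<Sum>j. 2 * b j / 3 ^ Suc j)"

lemma geometric_third: "(\<lambda>j. 2 / 3 ^ Suc j :: real) sums 1"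
  using sums_mult[OF geometric_sums[of "1/3::real"], of "2/3"] by (simp add: power_divide)

lemma
  assumes "\<And>j. b j \<in> {0, 1}"
  shows summable_cantor: "summable (\<lambda>j. 2 * b j / 3 ^ Suc j :: real)"
    and cantor_sum_nonneg: "0 \<le> cantor_sum b"
    and cantor_sum_le_1: "cantor_sum b \<le> 1"
proof -
  have b: "0 \<le> b j" "b j \<le> 1" for j using assms[of j] by auto
  show 1: "summable (\<lambda>j. 2 * b j / 3 ^ Suc j :: real)"
    by (rule summable_comparison_test'[OF sums_summable[OF geometric_third], of 0])
      (use b in \<open>auto simp: abs_mult divide_simps\<close>)
  show "0 \<le> cantor_sum b"
    unfolding cantor_sum_def by (rule suminf_nonneg[OF 1]) (use b in auto)
  have "cantor_sum b \<le> (\<Sum>j. 2 / 3 ^ Suc j)"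
    unfolding cantor_sum_def
    by (rule suminf_le[OF _ 1 sums_summable[OF geometric_third]]) (use b in \<open>auto simp: divide_simps\<close>)
  then show "cantor_sum b \<le> 1" using sums_unique[OF geometric_third] by simp
qed

lemma cantor_sum_shift:
  assumes "\<And>j. b j \<in> {0, 1}"
  shows "3 * cantor_sum b = 2 * b 0 + cantor_sum (\<lambda>j. b (Suc j))"
proof -
  have "cantor_sum b = 2 * b 0 / 3 + (\<Sum>j. 2 * b (Suc j) / 3 ^ Suc (Suc j))"
    unfolding cantor_sum_def using suminf_split_head[OF summable_cantor, of b] assms by simp
  also have "(\<Sum>j. 2 * b (Suc j) / 3 ^ Suc (Suc j)) = (\<Sum>j. 1/3 * (2 * b (Suc j) / 3 ^ Suc j))"
    by simp
  also have "\<dots> = 1/3 * cantor_sum (\<lambda>j. b (Suc j))"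
    unfolding cantor_sum_def by (rule suminf_mult, rule summable_cantor) (rule assms)
  finally show ?thesis by simp
qed

text \<open>All ternary digits are even, so the digits moved in front of the point form an even
  integer, which the period 2 of \<open>zigzag\<close> discards.\<close>

lemma cantor_sum_power:
  assumes "\<And>j. b j \<in> {0, 1}"
  shows "\<exists>m. 3 ^ j * cantor_sum b = 2 * real m + cantor_sum (\<lambda>i. b (i + j))"
proof (induction j)
  case 0
  show ?case by (rule exI[of _ 0]) simp
next
  case (Suc j)
  then obtain m where m: "3 ^ j * cantor_sum b = 2 * real m + cantor_sum (\<lambda>i. b (i + j))" by blast
  obtain l :: nat where l: "b j = real l" using assms[of j] by (metis empty_iff insert_iff of_nat_0 of_nat_1)
  have "3 ^ Suc j * cantor_sum b = 6 * real m + 3 * cantor_sum (\<lambda>i. b (i + j))"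
    using m by simp
  also have "\<dots> = 2 * real (3 * m + l) + cantor_sum (\<lambda>i. b (i + Suc j))"
    using cantor_sum_shift[of "\<lambda>i. b (i + j)"] assms l by simp
  finally show ?case by blast
qed

lemma zigzag_cantor_sum:
  assumes "\<And>j. b j \<in> {0, 1}"
  shows "zigzag (3 ^ j * cantor_sum b) = b j"
proof -
  obtain m where m: "3 ^ j * cantor_sum b = 2 * real m + cantor_sum (\<lambda>i. b (i + j))"
    using cantor_sum_power[of b j] assms by blast
  define r where "r = cantor_sum (\<lambda>i. b (Suc i + j))"
  have r: "0 \<le> r" "r \<le> 1"
    unfolding r_def by (rule cantor_sum_nonneg cantor_sum_le_1, rule assms)+
  have "cantor_sum (\<lambda>i. b (i + j)) = 2 * b j / 3 + r / 3"
    using cantor_sum_shift[of "\<lambda>i. b (i + j)"] assms by (simp add: r_def)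
  \<comment> \<open>As r lies in [0, 1], the argument lies in the first third for digit 0 and in the
    last third for digit 1, where \<open>zigzag\<close> is constant.\<close>
  moreover from assms[of j] consider "b j = 0" | "b j = 1" by blast
  then have "zigzag (2 * real m + (2 * b j / 3 + r / 3)) = b j"
    by cases (simp, rule zigzag_eq_0, use r in simp_all, rule zigzag_eq_1, use r in simp_all)
  ultimately show ?thesis using m by simp
qed

text \<open>Writing the digit as a difference of floors makes it a Borel function of u; index k
  carries the weight \<open>1 / 2 ^ Suc k\<close>.\<close>

definition bin_digit :: "nat \<Rightarrow> real \<Rightarrow> real" where
  "bin_digit k u = real_of_int \<lfloor>2 ^ Suc k * u\<rfloor> - 2 * real_of_int \<lfloor>2 ^ k * u\<rfloor>"

lemma bin_digit_01: "bin_digit k u \<in> {0, 1}"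
proof -
  define v where "v = 2 ^ k * u"
  have "\<lfloor>2 * v\<rfloor> - 2 * \<lfloor>v\<rfloor> = 0 \<or> \<lfloor>2 * v\<rfloor> - 2 * \<lfloor>v\<rfloor> = 1" by linarith
  then have "real_of_int (\<lfloor>2 * v\<rfloor> - 2 * \<lfloor>v\<rfloor>) \<in> {0, 1}" by (elim disjE) simp_all
  then show ?thesis by (simp add: bin_digit_def v_def mult.assoc)
qed

lemma bin_digit_sums:
  assumes "0 \<le> u" "u < 1"
  shows "(\<lambda>k. bin_digit k u / 2 ^ Suc k) sums u"
proof -
  \<comment> \<open>The sum telescopes to the dyadic truncation of u; the start of the induction
    uses that u has integer part 0.\<close>
  have eq: "(\<Sum>k<K. bin_digit k u / 2 ^ Suc k) = real_of_int \<lfloor>2 ^ K * u\<rfloor> / 2 ^ K" for K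
  proof (induction K)
    case 0
    have "\<lfloor>u\<rfloor> = 0" using assms by linarith
    then show ?case by simp
  next
    case (Suc K)
    then show ?case by (simp add: bin_digit_def field_simps)
  qed
  have "(\<lambda>K. real_of_int \<lfloor>2 ^ K * u\<rfloor> / 2 ^ K) \<longlonglongrightarrow> u"
  proof (rule tendsto_sandwich)
    show "\<forall>\<^sub>F K in sequentially. u - (1/2) ^ K \<le> real_of_int \<lfloor>2 ^ K * u\<rfloor> / 2 ^ K"
    proof (intro always_eventually allI)
      fix K
      have "2 ^ K * u - 1 \<le> real_of_int \<lfloor>2 ^ K * u\<rfloor>" by linarith
      then have "(2 ^ K * u - 1) / 2 ^ K \<le> real_of_int \<lfloor>2 ^ K * u\<rfloor> / 2 ^ K"
        by (intro divide_right_mono) auto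
      then show "u - (1/2) ^ K \<le> real_of_int \<lfloor>2 ^ K * u\<rfloor> / 2 ^ K"
        by (simp add: diff_divide_distrib power_divide)
    qed
    show "\<forall>\<^sub>F K in sequentially. real_of_int \<lfloor>2 ^ K * u\<rfloor> / 2 ^ K \<le> u"
      by (intro always_eventually allI) (simp add: divide_simps mult.commute)
    have "(\<lambda>K. u - (1/2) ^ K) \<longlonglongrightarrow> u - 0"
      by (intro tendsto_intros LIMSEQ_power_zero) auto
    then show "(\<lambda>K. u - (1/2) ^ K) \<longlonglongrightarrow> u" by simp
  qed simp
  then show ?thesis unfolding sums_def eq .
qed

lemma borel_measurable_vec_nth [measurable]:
  "(\<lambda>x :: real ^ 'n::finite. x $ i) \<in> borel_measurable borel"
  by (intro borel_measurable_continuous_onI continuous_intros)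

text \<open>Binary digit k of coordinate i is stored at ternary position
  \<open>k * N + idx i\<close>, and the curve reads it back with \<open>zigzag\<close>. Reading is
  continuous while storing is only Borel, which suffices: limits are taken on the line and pushed
  forward by the curve.\<close>

lemma borel_section_of_continuous_curve:
  "\<exists>(g :: real \<Rightarrow> real ^ 'n::finite) (s :: real ^ 'n \<Rightarrow> real).
     continuous_on UNIV g \<and> s \<in> borel_measurable borel \<and>
     (\<forall>x. s x \<in> {0..1}) \<and> (\<forall>x. norm x \<le> 1 \<longrightarrow> g (s x) = x)"
proof -
  define N where "N = CARD('n)"
  have N: "N > 0" by (simp add: N_def)
  obtain e where e: "bij_betw e {0..<N} (UNIV :: 'n set)"
    using ex_bij_betw_nat_finite[of "UNIV :: 'n set"] by (auto simp: N_def)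
  define idx where "idx = inv_into {0..<N} e"
  have idx: "idx i < N" "e (idx i) = i" for i
    using bij_betw_inv_into_right[OF e, of i] bij_betw_imp_surj_on[OF bij_betw_inv_into[OF e]]
    by (auto simp: idx_def)
  \<comment> \<open>A coordinate in [-1, 1] is sent to [1/4, 3/4], safely inside [0, 1), where the
    binary expansion is available; \<open>g\<close> undoes this affine map.\<close>
  define b where "b x j = bin_digit (j div N) ((x $ e (j mod N) + 2) / 4)" for x :: "real ^ 'n" and j
  have b01: "b x j \<in> {0, 1}" for x j unfolding b_def by (rule bin_digit_01)
  define s where "s x = cantor_sum (b x)" for x
  define g :: "real \<Rightarrow> real ^ 'n" where "g t = (\<chi> i. 4 * (\<Sum>k. zigzag (3 ^ (k * N + idx i) * t) / 2 ^ Suc k) - 2)" for t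
  have "g (s x) = x" if "norm x \<le> 1" for x
  proof -
    have "g (s x) $ i = x $ i" for i
    proof -
      have "\<bar>x $ i\<bar> \<le> 1" using component_le_norm_cart[of x i] that by simp
      then have "(\<lambda>k. bin_digit k ((x $ i + 2) / 4) / 2 ^ Suc k) sums ((x $ i + 2) / 4)"
        by (intro bin_digit_sums) auto
      moreover have "zigzag (3 ^ (k * N + idx i) * s x) = bin_digit k ((x $ i + 2) / 4)" for k
        unfolding s_def
        by (subst zigzag_cantor_sum[OF b01]) (use idx[of i] N in \<open>simp add: b_def\<close>)
      ultimately have S: "(\<Sum>k. zigzag (3 ^ (k * N + idx i) * s x) / 2 ^ Suc k) = (x $ i + 2) / 4"
        by (simp add: sums_iff)
      have "4 * ((x $ i + 2) / 4) - 2 = x $ i" by (simp add: field_simps)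
      then show ?thesis unfolding g_def vec_lambda_beta S .
    qed
    then show ?thesis by (simp add: vec_eq_iff)
  qed
  moreover have "s x \<in> {0..1}" for x
    using cantor_sum_nonneg[of "b x"] cantor_sum_le_1[of "b x"] b01 by (simp add: s_def)
  moreover have "s \<in> borel_measurable borel"
    unfolding s_def cantor_sum_def b_def bin_digit_def by measurable
  moreover have "continuous_on UNIV g"
    unfolding g_def
  proof (intro continuous_on_vec_lambda continuous_intros)
    fix i
    show "continuous_on UNIV (\<lambda>t. \<Sum>k. zigzag (3 ^ (k * N + idx i) * t) / 2 ^ Suc k)"
    proof (rule uniform_limit_theorem)
      show "uniform_limit UNIV (\<lambda>K t. \<Sum>k<K. zigzag (3 ^ (k * N + idx i) * t) / 2 ^ Suc k)
          (\<lambda>t. \<Sum>k. zigzag (3 ^ (k * N + idx i) * t) / 2 ^ Suc k) sequentially"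
      proof (rule Weierstrass_m_test)
        fix k t
        show "norm (zigzag (3 ^ (k * N + idx i) * t) / 2 ^ Suc k) \<le> (1/2) ^ Suc k"
          using zigzag_bounds[of "3 ^ (k * N + idx i) * t"] by (simp add: power_divide divide_simps)
        show "summable (\<lambda>k. (1/2::real) ^ Suc k)"
          by (subst summable_Suc_iff) (rule summable_geometric, simp)
      qed
      show "\<forall>\<^sub>F K in sequentially. continuous_on UNIV
          (\<lambda>t. \<Sum>k<K. zigzag (3 ^ (k * N + idx i) * t) / 2 ^ Suc k)"
        unfolding zigzag_def by (intro always_eventually allI continuous_intros) auto
    qed simp
  qed
  ultimately show ?thesis by blast
qed

section \<open>Almost sure subsequential limits of probability measures on the sphere\<close>

abbreviation sphere_borel :: "(real ^ 'n::finite) measure" where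
  "sphere_borel \<equiv> restrict_space borel (sphere 0 1)"

lemma space_sphere_borel [simp]: "space sphere_borel = sphere 0 1"
  by (simp add: space_restrict_space)

lemma sphere_probsD:
  assumes "\<mu> \<in> sphere_probs"
  shows "prob_space \<mu>" "sets \<mu> = sets sphere_borel" "space \<mu> = sphere 0 1"
    "(\<lambda>x. x) \<in> borel_measurable \<mu>"
proof -
  show 1: "prob_space \<mu>" "sets \<mu> = sets sphere_borel"
    using assms by (auto simp: sphere_probs_def)
  show "space \<mu> = sphere 0 1" using sets_eq_imp_space_eq[OF 1(2)] by simp
  show "(\<lambda>x. x) \<in> borel_measurable \<mu>"
    using measurable_cong_sets[OF 1(2) refl, of borel] measurable_restrict_space1[of "\<lambda>x. x" borel borel]
    by auto
qed

lemma distr_sphere_probs: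
  assumes "prob_space \<Omega>" "X \<in> \<Omega> \<rightarrow>\<^sub>M sphere_borel"
  shows "distr \<Omega> sphere_borel X \<in> sphere_probs"
  using prob_space.prob_space_distr[OF assms] by (simp add: sphere_probs_def)

lemma sphere_nonempty: "\<exists>e :: real ^ 'n::finite. e \<in> sphere 0 1"
  by (rule exI[of _ "axis undefined 1"]) (simp add: norm_axis_1)

text \<open>The pushed-forward laws live on [0, 1] and are therefore tight. The section is not
  assumed continuous, so the limit \<open>Y0\<close> may leave its range; still
  \<open>g (Y0 \<omega>)\<close> is almost surely on the sphere, as a limit of points of a closed
  set.\<close>

lemma sphere_probs_subsequence_coupling:
  fixes \<mu> :: "nat \<Rightarrow> (real ^ 'n::finite) measure"
  assumes \<mu>: "\<And>k. \<mu> k \<in> sphere_probs"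
  shows "\<exists>(r :: nat \<Rightarrow> nat) (\<Omega> :: real measure) X Y.
     strict_mono r \<and> prob_space \<Omega> \<and>
     (\<forall>k. X k \<in> \<Omega> \<rightarrow>\<^sub>M sphere_borel \<and> distr \<Omega> sphere_borel (X k) = \<mu> (r k)) \<and>
     Y \<in> \<Omega> \<rightarrow>\<^sub>M sphere_borel \<and> (AE \<omega> in \<Omega>. (\<lambda>k. X k \<omega>) \<longlonglongrightarrow> Y \<omega>)"
proof -
  obtain g :: "real \<Rightarrow> real ^ 'n" and s where cont: "continuous_on UNIV g"
    and s [measurable]: "s \<in> borel_measurable borel"
    and s01: "\<And>x. s x \<in> {0..1}" and gs: "\<And>x. norm x \<le> 1 \<Longrightarrow> g (s x) = x"
    using borel_section_of_continuous_curve by metis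
  have [measurable]: "g \<in> borel_measurable borel"
    by (rule borel_measurable_continuous_onI[OF cont])
  obtain z :: "real ^ 'n" where z: "z \<in> sphere 0 1" using sphere_nonempty by blast
  \<comment> \<open>The default \<open>z\<close> makes the variables sphere-valued at every sample
    point; almost surely \<open>f\<close> acts as the identity.\<close>
  define f where "f x = (if x \<in> sphere 0 1 then x else z)" for x :: "real ^ 'n"
  have [measurable]: "sphere 0 1 \<in> sets (borel :: (real ^ 'n) measure)" by (simp add: borel_closed)
  have f [measurable]: "f \<in> borel \<rightarrow>\<^sub>M sphere_borel"
  proof (rule measurable_restrict_space2)
    show "f \<in> space borel \<rightarrow> sphere 0 1" using z by (auto simp: f_def)
    show "f \<in> borel_measurable borel" unfolding f_def by measurable
  qed
  have s' [measurable]: "s \<in> borel_measurable (\<mu> k)" for k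
    using measurable_compose[OF sphere_probsD(4)[OF \<mu>] s] .
  define \<nu> where "\<nu> k = distr (\<mu> k) borel s" for k
  have rd: "real_distribution (\<nu> k)" for k
    unfolding \<nu>_def using prob_space.real_distribution_distr[OF sphere_probsD(1)[OF \<mu>] s'] .
  have "tight \<nu>"
    unfolding tight_def
  proof (intro conjI allI impI rd)
    fix \<epsilon> :: real assume "\<epsilon> > 0"
    \<comment> \<open>Tightness is stated with left-open intervals and \<open>s\<close> may take the
      value 0, so the left end has to be negative.\<close>
    have "measure (\<nu> k) {-1<..1} = 1" for k
    proof -
      have "s -` {-1<..1} \<inter> space (\<mu> k) = space (\<mu> k)"
        using s01 by (auto simp: subset_eq) (smt (verit))
      then show ?thesis
        unfolding \<nu>_def by (subst measure_distr) (auto intro!: prob_space.prob_space sphere_probsD[OF \<mu>])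
    qed
    then show "\<exists>a b. a < b \<and> (\<forall>k. 1 - \<epsilon> < measure (\<nu> k) {a<..b})"
      using \<open>\<epsilon> > 0\<close> by (intro exI[of _ "-1"] exI[of _ 1]) auto
  qed
  from tight_imp_convergent_subsubsequence[OF this strict_mono_id] obtain r M where
    r: "strict_mono r" and M: "real_distribution M" and conv: "weak_conv_m (\<nu> \<circ> r) M" by auto
  have rd': "real_distribution ((\<nu> \<circ> r) k)" for k using rd by simp
  obtain \<Omega> :: "real measure" and Y and Y0 where
    \<Omega>: "prob_space \<Omega>" and Y [measurable]: "\<And>k. Y k \<in> borel_measurable \<Omega>"
    and dY': "\<And>k. distr \<Omega> borel (Y k) = (\<nu> \<circ> r) k"
    and Y0: "Y0 \<in> measurable \<Omega> lborel"
    and lim: "\<And>x. x \<in> space \<Omega> \<Longrightarrow> (\<lambda>k. Y k x) \<longlonglongrightarrow> Y0 x"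
    using Skorohod[OF rd' M conv] by blast
  have dY: "distr \<Omega> borel (Y k) = \<nu> (r k)" for k using dY' by simp
  have [measurable]: "Y0 \<in> borel_measurable \<Omega>" using Y0 by simp
  have dX: "distr \<Omega> sphere_borel (\<lambda>\<omega>. f (g (Y k \<omega>))) = \<mu> (r k)" for k
  proof -
    have "distr \<Omega> sphere_borel (\<lambda>\<omega>. f (g (Y k \<omega>))) = distr (distr \<Omega> borel (Y k)) sphere_borel (\<lambda>t. f (g t))"
      by (subst distr_distr) (auto simp: comp_def)
    also have "\<dots> = distr (\<mu> (r k)) sphere_borel (\<lambda>x. f (g (s x)))"
      unfolding dY \<nu>_def by (subst distr_distr) (auto simp: comp_def)
    also have "\<dots> = distr (\<mu> (r k)) (\<mu> (r k)) (\<lambda>x. x)"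
      by (rule distr_cong) (auto simp: sphere_probsD[OF \<mu>] gs f_def)
    finally show ?thesis by (simp add: distr_id)
  qed
  have AEs: "AE \<omega> in \<Omega>. g (Y k \<omega>) \<in> sphere 0 1" for k
  proof -
    \<comment> \<open>On the sample space only the law of \<open>Y k\<close> is known, so being
      mapped to the sphere is expressed as a property of that law and pulled back.\<close>
    have "AE x in \<mu> (r k). g (s x) \<in> sphere 0 1"
      by (rule AE_I2) (auto simp: sphere_probsD[OF \<mu>] gs)
    then have "AE t in distr (\<mu> (r k)) borel s. g t \<in> sphere 0 1"
      by (subst AE_distr_iff) auto
    then have "AE t in distr \<Omega> borel (Y k). g t \<in> sphere 0 1"
      unfolding dY \<nu>_def .
    then show ?thesis by (subst (asm) AE_distr_iff) auto
  qed
  have all: "AE \<omega> in \<Omega>. \<forall>k. g (Y k \<omega>) \<in> sphere 0 1"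
    using AEs by (simp add: AE_all_countable)
  have "AE \<omega> in \<Omega>. (\<lambda>k. f (g (Y k \<omega>))) \<longlonglongrightarrow> f (g (Y0 \<omega>))"
    using all AE_space[of \<Omega>]
  proof eventually_elim
    case (elim \<omega>)
    have "(\<lambda>k. g (Y k \<omega>)) \<longlonglongrightarrow> g (Y0 \<omega>)"
      using lim[of \<omega>] cont elim
      by (intro isCont_tendsto_compose[of _ g]) (auto simp: continuous_on_eq_continuous_at)
    moreover from this have "g (Y0 \<omega>) \<in> sphere 0 1"
      using elim by (intro Lim_in_closed_set[of "sphere 0 1"]) auto
    ultimately show ?case using elim by (simp add: f_def)
  qed
  then show ?thesis
    using r \<Omega> dX
    by (intro exI[of _ r] exI[of _ \<Omega>] exI[of _ "\<lambda>k \<omega>. f (g (Y k \<omega>))"] exI[of _ "\<lambda>\<omega>. f (g (Y0 \<omega>))"]) auto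
qed

section \<open>Measures on orthogonal axes\<close>

text \<open>Spanning is left out on purpose: the axes carrying a measure are found as a maximal
  orthonormal set, and only the energy value shows later that there are enough of them.\<close>

definition orthonormal :: "'a::real_inner set \<Rightarrow> bool" where
  "orthonormal B \<longleftrightarrow> pairwise orthogonal B \<and> (\<forall>v\<in>B. norm v = 1)"

lemma orthonormal_inner:
  assumes "orthonormal B" "v \<in> B" "w \<in> B"
  shows "v \<bullet> w = (if v = w then 1 else 0)"
  using assms by (auto simp: orthonormal_def pairwise_def orthogonal_def norm_eq_1)

lemma orthonormal_independent: "orthonormal B \<Longrightarrow> independent B"
  by (rule pairwise_orthogonal_independent) (auto simp: orthonormal_def)

lemma orthonormal_finite:
  fixes B :: "'a::euclidean_space set"
  assumes "orthonormal B"
  shows "finite B" "card B \<le> DIM('a)"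
  using independent_bound[OF orthonormal_independent[OF assms]] by auto

lemma orthonormal_basis_iff:
  fixes B :: "(real ^ 'n::finite) set"
  shows "orthonormal_basis B \<longleftrightarrow> orthonormal B \<and> card B = CARD('n)"
proof
  assume B: "orthonormal_basis B"
  then have "dim (span B) = card B"
    by (intro dim_span_eq_card_independent) (simp add: orthonormal_basis_def)
  moreover have "span B = UNIV" using B by (simp add: orthonormal_basis_def)
  ultimately have "card B = CARD('n)" by (metis dim_UNIV DIM_cart DIM_real mult.right_neutral)
  then show "orthonormal B \<and> card B = CARD('n)"
    using B by (auto simp: orthonormal_basis_def orthonormal_def)
next
  assume B: "orthonormal B \<and> card B = CARD('n)"
  have "UNIV \<subseteq> span B"
    by (rule card_ge_dim_independent) (use B orthonormal_independent in auto)
  then show "orthonormal_basis B"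
    using B orthonormal_independent[of B] by (auto simp: orthonormal_basis_def orthonormal_def)
qed

lemma orthonormal_basis_Parseval:
  fixes B :: "(real ^ 'n::finite) set"
  assumes "orthonormal_basis B"
  shows "(\<Sum>v\<in>B. (x \<bullet> v)\<^sup>2) = (norm x)\<^sup>2"
proof -
  have B: "orthonormal B" "finite B" using assms orthonormal_basis_iff orthonormal_finite by auto
  have "x = (\<Sum>v\<in>B. (x \<bullet> v) *\<^sub>R v)"
    using orthonormal_basis_expand[of B x] assms B by (auto simp: orthonormal_basis_def)
  then have "x \<bullet> x = (\<Sum>v\<in>B. (x \<bullet> v) *\<^sub>R v) \<bullet> x" by simp
  also have "\<dots> = (\<Sum>v\<in>B. (x \<bullet> v)\<^sup>2)"
    by (subst inner_sum_left) (simp add: power2_eq_square inner_commute)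
  finally show ?thesis by (simp add: power2_norm_eq_inner)
qed

definition axes :: "(real ^ 'n::finite) set \<Rightarrow> (real ^ 'n) set" where
  "axes B = (\<Union>v\<in>B. {v, - v})"

lemma orthonormal_antipodal:
  assumes "orthonormal B" "v \<in> B" "w \<in> B" "x \<in> {v, - v}" "x \<in> {w, - w}"
  shows "v = w"
proof (rule ccontr)
  assume "v \<noteq> w"
  then have "v \<bullet> w = 0" "v \<bullet> v = 1" "w \<bullet> w = 1" using orthonormal_inner[OF assms(1)] assms by auto
  then show False using assms(4,5) by auto
qed

text \<open>Points on the axes are parallel or orthogonal, where the kernel is 0 or 1 for every
  exponent. The bilinear form of the right-hand side turns the energy into a polynomial in the
  masses of the axes.\<close>

lemma kpow_axes:
  assumes B: "orthonormal B" and x: "x \<in> axes B" and y: "y \<in> axes B"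
  shows "kpow \<alpha> x y = 1 - (\<Sum>v\<in>B. indicator {v, - v} x * indicator {v, - v} y)"
proof -
  obtain u w where u: "u \<in> B" "x \<in> {u, - u}" and w: "w \<in> B" "y \<in> {w, - w}"
    using x y by (auto simp: axes_def)
  have ix: "indicator {v, - v} x = (if v = u then 1 else 0 :: real)" if "v \<in> B" for v
  proof (cases "v = u")
    case False
    then have "x \<notin> {v, - v}" using orthonormal_antipodal[OF B that u(1) _ u(2)] by blast
    then show ?thesis using False by simp
  qed (use u(2) in simp)
  have "(\<Sum>v\<in>B. indicator {v, - v} x * indicator {v, - v} y) =
      (\<Sum>v\<in>B. if v = u then indicator {v, - v} y else 0 :: real)"
    by (rule sum.cong) (auto simp: ix)
  also have "\<dots> = indicator {u, - u} y"
    using u orthonormal_finite[OF B] by simp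
  also have "\<dots> = (if u = w then 1 else 0)"
  proof (cases "u = w")
    case False
    then have "y \<notin> {u, - u}" using orthonormal_antipodal[OF B u(1) w(1) _ w(2)] by blast
    then show ?thesis using False by simp
  qed (use w(2) in simp)
  finally have *: "(\<Sum>v\<in>B. indicator {v, - v} x * indicator {v, - v} y) = (if u = w then 1 else 0 :: real)" .
  have "x \<bullet> y = (if u = w then x \<bullet> y else 0)" and "u = w \<Longrightarrow> \<bar>x \<bullet> y\<bar> = 1"
    using u w orthonormal_inner[OF B u(1) w(1)] by auto
  then show ?thesis unfolding * using kpow_parallel[of x y \<alpha>] kpow_orthogonal[of x y \<alpha>] by auto
qed

section \<open>Energy of a single measure\<close>

definition bounded_kernel :: "(real ^ 'n::finite \<Rightarrow> real ^ 'n \<Rightarrow> real) \<Rightarrow> bool" where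
  "bounded_kernel F \<longleftrightarrow> case_prod F \<in> borel_measurable (borel \<Otimes>\<^sub>M borel) \<and> (\<exists>c. \<forall>x y. \<bar>F x y\<bar> \<le> c)"

locale sphere_prob = prob_space \<mu> for \<mu> :: "(real ^ 'n::finite) measure" +
  assumes sphere_prob: "\<mu> \<in> sphere_probs"
begin

lemmas sets_mu = sphere_probsD(2)[OF sphere_prob]
lemmas space_mu = sphere_probsD(3)[OF sphere_prob]
lemmas id_measurable [measurable] = sphere_probsD(4)[OF sphere_prob]

lemma borel_measurable_mu: "f \<in> borel \<rightarrow>\<^sub>M N \<Longrightarrow> f \<in> \<mu> \<rightarrow>\<^sub>M N"
  using measurable_compose[OF id_measurable] by simp

lemma sets_mu_borel: "A \<in> sets borel \<Longrightarrow> A \<inter> sphere 0 1 \<in> sets \<mu>"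
  by (auto simp: sets_mu sets_restrict_space)

lemma sets_antipodal: "norm v = 1 \<Longrightarrow> {v, - v} \<in> sets \<mu>"
  using sets_mu_borel[of "{v, - v}"] by (simp add: Int_absorb2)

lemma
  assumes "bounded_kernel F"
  shows kernel_integrable: "integrable \<mu> (F x)"
    and kernel_integrable_iterated: "integrable \<mu> (\<lambda>x. LINT y|\<mu>. F x y)"
    and kernel_swap: "(LINT x|\<mu>. LINT y|\<mu>. F x y) = (LINT y|\<mu>. LINT x|\<mu>. F x y)"
proof -
  obtain c where m: "case_prod F \<in> borel_measurable (borel \<Otimes>\<^sub>M borel)" and c: "\<And>x y. \<bar>F x y\<bar> \<le> c"
    using assms by (auto simp: bounded_kernel_def)
  interpret P: pair_prob_space \<mu> \<mu> ..
  have "(\<lambda>p. (fst p, snd p)) \<in> \<mu> \<Otimes>\<^sub>M \<mu> \<rightarrow>\<^sub>M borel \<Otimes>\<^sub>M borel"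
    by (rule measurable_Pair[OF measurable_compose[OF measurable_fst id_measurable]
          measurable_compose[OF measurable_snd id_measurable]])
  from measurable_compose[OF this m] have m2 [measurable]: "case_prod F \<in> borel_measurable (\<mu> \<Otimes>\<^sub>M \<mu>)"
    by (simp add: split_beta')
  have i2: "integrable (\<mu> \<Otimes>\<^sub>M \<mu>) (case_prod F)"
    by (rule P.integrable_const_bound[of _ c]) (use c m2 in auto)
  have "(\<lambda>y. (x, y)) \<in> borel \<rightarrow>\<^sub>M borel \<Otimes>\<^sub>M (borel :: (real ^ 'n) measure)" by measurable
  from measurable_compose[OF this m] have "F x \<in> borel_measurable \<mu>"
    by (intro borel_measurable_mu) simp
  then show "integrable \<mu> (F x)"
    by (intro integrable_const_bound[of _ c]) (use c in auto)
  show "integrable \<mu> (\<lambda>x. LINT y|\<mu>. F x y)"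
    using P.integrable_fst'[OF i2] by simp
  show "(LINT x|\<mu>. LINT y|\<mu>. F x y) = (LINT y|\<mu>. LINT x|\<mu>. F x y)"
    using P.Fubini_integral[OF i2] by simp
qed

lemma bounded_kernel_kpow: "0 < \<alpha> \<Longrightarrow> bounded_kernel (kpow \<alpha>)"
  unfolding bounded_kernel_def
  by (intro conjI exI[of _ 1] allI) (auto simp: kpow_nonneg kpow_le_1 split_beta')

lemma energy_eq: "energy \<alpha> \<mu> = 1 / 2 * (LINT x|\<mu>. LINT y|\<mu>. kpow \<alpha> x y)"
  unfolding energy_def
  by (intro arg_cong[of _ _ "\<lambda>t. 1 / 2 * t"] Bochner_Integration.integral_cong refl)
    (auto simp: space_mu Lam_pow_def kpow_def Lam_eq_clam)

lemma energy_antimono: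
  assumes "0 < \<alpha>" "\<alpha> \<le> \<beta>"
  shows "energy \<beta> \<mu> \<le> energy \<alpha> \<mu>"
proof -
  have "0 < \<beta>" using assms by order
  then show ?thesis
    unfolding energy_eq using assms
    by (intro mult_left_mono integral_mono kernel_integrable_iterated kernel_integrable
        bounded_kernel_kpow kpow_antimono) auto
qed

text \<open>The difference of the two kernels is nonnegative with double integral 0, so it vanishes
  almost everywhere, and strict monotonicity in the exponent excludes all other angles.\<close>

lemma energy_eq_imp_AE:
  assumes "0 < \<alpha>" "\<alpha> < \<beta>" "energy \<beta> \<mu> = energy \<alpha> \<mu>"
  shows "AE x in \<mu>. AE y in \<mu>. x \<bullet> y = 0 \<or> \<bar>x \<bullet> y\<bar> = 1"
proof -
  have "0 < \<beta>" using assms by order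
  note [intro] = kernel_integrable_iterated kernel_integrable bounded_kernel_kpow
    \<open>0 < \<alpha>\<close> \<open>0 < \<beta>\<close>
  define h where "h x = (LINT y|\<mu>. kpow \<alpha> x y) - (LINT y|\<mu>. kpow \<beta> x y)" for x
  have h: "h x = (LINT y|\<mu>. kpow \<alpha> x y - kpow \<beta> x y)" for x
    unfolding h_def by (rule Bochner_Integration.integral_diff[symmetric]) auto
  have nn: "0 \<le> kpow \<alpha> x y - kpow \<beta> x y" for x y
    using kpow_antimono[OF \<open>0 < \<alpha>\<close> less_imp_le[OF \<open>\<alpha> < \<beta>\<close>]] by simp
  have "(LINT x|\<mu>. h x) = 0"
    unfolding h_def using assms(3)
    by (subst Bochner_Integration.integral_diff) (auto simp: energy_eq)
  moreover have "integrable \<mu> h"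
    unfolding h_def by (intro Bochner_Integration.integrable_diff) auto
  moreover have "AE x in \<mu>. 0 \<le> h x"
    unfolding h by (intro AE_I2 Bochner_Integration.integral_nonneg nn)
  ultimately have "AE x in \<mu>. h x = 0"
    using integral_nonneg_eq_0_iff_AE[of \<mu> h] by simp
  then show ?thesis
    using AE_space[of \<mu>]
  proof eventually_elim
    case (elim x)
    have "AE y in \<mu>. kpow \<alpha> x y - kpow \<beta> x y = 0"
      using elim nn unfolding h
      by (subst integral_nonneg_eq_0_iff_AE[symmetric]) (auto intro!: Bochner_Integration.integrable_diff)
    then show ?case
      using AE_space[of \<mu>]
    proof eventually_elim
      case (elim y)
      have "\<bar>x \<bullet> y\<bar> \<le> 1"
        using \<open>x \<in> space \<mu>\<close> \<open>y \<in> space \<mu>\<close> by (intro abs_inner_unit_le) (auto simp: space_mu)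
      then show ?case
        using kpow_strict_antimono[OF \<open>0 < \<alpha>\<close> \<open>\<alpha> < \<beta>\<close>, of x y] elim by fastforce
    qed
  qed
qed

lemma energy_axes:
  assumes B: "orthonormal B" and AE: "AE x in \<mu>. x \<in> axes B"
  shows "energy \<alpha> \<mu> = 1 / 2 * (1 - (\<Sum>v\<in>B. (prob {v, - v})\<^sup>2))"
proof -
  have [measurable]: "{v, - v} \<in> sets \<mu>" if "v \<in> B" for v
    using B that by (intro sets_antipodal) (auto simp: orthonormal_def)
  have m [measurable]: "kpow \<alpha> x \<in> borel_measurable \<mu>" for x
    by (rule borel_measurable_mu) measurable
  have meas: "(\<lambda>y. indicator {v, - v} y :: real) \<in> borel_measurable \<mu>" if "v \<in> B" for v
    by (rule borel_measurable_mu) simp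
  have int: "integrable \<mu> (\<lambda>y. indicator {v, - v} y :: real)" if "v \<in> B" for v
    by (rule integrable_const_bound[of _ 1]) (use meas[OF that] in \<open>auto simp: indicator_def\<close>)
  have i: "(LINT y|\<mu>. indicator {v, - v} y) = prob {v, - v}" if "v \<in> B" for v
    using that by simp
  have inner: "(LINT y|\<mu>. kpow \<alpha> x y) = 1 - (\<Sum>v\<in>B. indicator {v, - v} x * prob {v, - v})"
    if "x \<in> axes B" for x
  proof -
    have "(LINT y|\<mu>. kpow \<alpha> x y) = (LINT y|\<mu>. 1 - (\<Sum>v\<in>B. indicator {v, - v} x * indicator {v, - v} y))"
    proof (rule integral_cong_AE)
      show "AE y in \<mu>. kpow \<alpha> x y = 1 - (\<Sum>v\<in>B. indicator {v, - v} x * indicator {v, - v} y)"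
        using AE by eventually_elim (rule kpow_axes[OF B that])
    qed (use meas in \<open>auto intro!: borel_measurable_diff borel_measurable_sum borel_measurable_times\<close>)
    also have "\<dots> = 1 - (\<Sum>v\<in>B. indicator {v, - v} x * prob {v, - v})"
      using int i by (subst Bochner_Integration.integral_diff)
        (auto intro!: integrable_sum integrable_mult_right simp: integral_sum prob_space)
    finally show ?thesis .
  qed
  have "(LINT x|\<mu>. LINT y|\<mu>. kpow \<alpha> x y) = (LINT x|\<mu>. 1 - (\<Sum>v\<in>B. indicator {v, - v} x * prob {v, - v}))"
  proof (rule integral_cong_AE)
    show "AE x in \<mu>. (LINT y|\<mu>. kpow \<alpha> x y) = 1 - (\<Sum>v\<in>B. indicator {v, - v} x * prob {v, - v})"
      using AE by eventually_elim (rule inner)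
    show "(\<lambda>x. LINT y|\<mu>. kpow \<alpha> x y) \<in> borel_measurable \<mu>"
      by measurable
  qed (use meas in \<open>auto intro!: borel_measurable_diff borel_measurable_sum borel_measurable_times\<close>)
  also have "\<dots> = 1 - (\<Sum>v\<in>B. (prob {v, - v})\<^sup>2)"
    using int i by (subst Bochner_Integration.integral_diff)
      (auto intro!: integrable_sum integrable_mult_left simp: integral_sum prob_space power2_eq_square)
  finally show ?thesis by (simp add: energy_eq)
qed

text \<open>A maximal orthonormal set of typical points carries the whole mass.\<close>

lemma AE_axes_of_right_angles:
  assumes "AE x in \<mu>. AE y in \<mu>. x \<bullet> y = 0 \<or> \<bar>x \<bullet> y\<bar> = 1"
  shows "\<exists>B. orthonormal B \<and> (AE x in \<mu>. x \<in> axes B)"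
proof -
  \<comment> \<open>Membership in G is required of the basis vectors so that each of them is
    parallel or orthogonal to almost every point; as B is finite, one null set serves all of
    them.\<close>
  define G where "G = {x. norm x = 1 \<and> (AE y in \<mu>. x \<bullet> y = 0 \<or> \<bar>x \<bullet> y\<bar> = 1)}"
  define P where "P B \<longleftrightarrow> orthonormal B \<and> B \<subseteq> G" for B
  have "P {}" by (simp add: P_def orthonormal_def)
  moreover have "\<forall>B. P B \<longrightarrow> card B \<le> DIM(real ^ 'n)" using orthonormal_finite(2)[where 'a = "real ^ 'n"] by (auto simp: P_def)
  ultimately obtain B where B: "P B" and max: "\<And>B'. P B' \<Longrightarrow> card B' \<le> card B"
    using ex_has_greatest_nat[of P "{}" card "Suc (DIM(real ^ 'n))"] by (metis le_imp_less_Suc)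
  have fin: "finite B" using B orthonormal_finite(1) by (auto simp: P_def)
  have "AE y in \<mu>. y \<in> G"
    using assms AE_space[of \<mu>] by eventually_elim (auto simp: G_def space_mu)
  moreover have "AE y in \<mu>. \<forall>v\<in>B. v \<bullet> y = 0 \<or> \<bar>v \<bullet> y\<bar> = 1"
    using B by (intro AE_finite_allI[OF fin]) (auto simp: P_def G_def)
  ultimately have "AE y in \<mu>. y \<in> axes B"
  proof eventually_elim
    case (elim y)
    show "y \<in> axes B"
    proof (rule ccontr)
      assume y: "y \<notin> axes B"
      have "v \<bullet> y = 0" if v: "v \<in> B" for v
      proof (rule ccontr)
        assume "v \<bullet> y \<noteq> 0"
        then have *: "\<bar>v \<bullet> y\<bar> = 1" using elim v by auto
        have n: "v \<bullet> v = 1" "y \<bullet> y = 1" using v B elim by (auto simp: P_def G_def norm_eq_1)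
        \<comment> \<open>The equality case of Cauchy-Schwarz for unit vectors, written out.\<close>
        then have "(v - y) \<bullet> (v - y) = 0 \<or> (v + y) \<bullet> (v + y) = 0"
          using * by (auto simp: inner_diff inner_add inner_commute abs_if split: if_splits)
        then have "y = v \<or> y = - v" by (auto simp: add_eq_0_iff)
        then show False using y v by (auto simp: axes_def)
      qed
      then have "P (insert y B)"
        using B elim
        by (auto simp: P_def G_def orthonormal_def orthogonal_def pairwise_insert inner_commute)
      moreover have "y \<notin> B" using y by (auto simp: axes_def)
      ultimately show False using max[of "insert y B"] fin by simp
    qed
  qed
  then show ?thesis using B by (auto simp: P_def)
qed

lemma prob_axes:
  assumes "orthonormal B"
  shows "(\<Sum>v\<in>B. prob {v, - v}) = prob (axes B)" "axes B \<in> events"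
proof -
  have ev: "{v, - v} \<in> events" if "v \<in> B" for v
    using assms that by (intro sets_antipodal) (auto simp: orthonormal_def)
  show "(\<Sum>v\<in>B. prob {v, - v}) = prob (axes B)"
    unfolding axes_def
  proof (rule finite_measure_finite_Union[symmetric])
    show "disjoint_family_on (\<lambda>v. {v, - v}) B"
      unfolding disjoint_family_on_def
      using orthonormal_antipodal[OF assms] by blast
  qed (use ev orthonormal_finite[OF assms] in auto)
  show "axes B \<in> events"
    unfolding axes_def using ev orthonormal_finite[OF assms] by auto
qed

lemma P_Delta_eqD:
  assumes "\<mu> \<in> P_Delta_eq"
  shows "\<exists>B. orthonormal_basis B \<and> (AE x in \<mu>. x \<in> axes B) \<and>
    (\<forall>v\<in>B. prob {v, - v} = 1 / real CARD('n))"
proof -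
  obtain B where B: "orthonormal_basis B" "\<forall>v\<in>B. prob {v, - v} = 1 / real CARD('n)"
    using assms by (auto simp: P_Delta_eq_def)
  then have o: "orthonormal B" "card B = CARD('n)" using orthonormal_basis_iff by auto
  have "prob (axes B) = 1" using prob_axes(1)[OF o(1)] B o by simp
  then show ?thesis using B prob_eq_1[OF prob_axes(2)[OF o(1)]] by blast
qed

lemma energy_P_Delta_eq:
  assumes "\<mu> \<in> P_Delta_eq"
  shows "energy \<alpha> \<mu> = 1 / 2 * (1 - 1 / real CARD('n))"
proof -
  obtain B where B: "orthonormal_basis B" "AE x in \<mu>. x \<in> axes B"
    "\<forall>v\<in>B. prob {v, - v} = 1 / real CARD('n)"
    using P_Delta_eqD[OF assms] by auto
  then have o: "orthonormal B" "card B = CARD('n)" using orthonormal_basis_iff by auto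
  show ?thesis
    using B o by (simp add: energy_axes[OF o(1) B(2)] power2_eq_square)
qed

text \<open>The masses sum to 1 and, by the energy, their squares sum to 1 / N. The sum of squared
  deviations from 1 / N is then \<open>card B / N\<^sup>2 - 1 / N\<close>, at most 0 since an
  orthonormal set has at most N vectors. So all masses are 1 / N and B is a basis. Any single
  exponent will do.\<close>

lemma P_Delta_eqI:
  assumes B: "orthonormal B" and AE: "AE x in \<mu>. x \<in> axes B"
    and E: "energy \<alpha> \<mu> = 1 / 2 * (1 - 1 / real CARD('n))"
  shows "\<mu> \<in> P_Delta_eq"
proof -
  define N where "N = real CARD('n)"
  have N: "N > 0" by (simp add: N_def)
  have fin: "finite B" "card B \<le> CARD('n)" using orthonormal_finite[OF B] by auto
  have s1: "(\<Sum>v\<in>B. prob {v, - v}) = 1"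
    using prob_axes[OF B] AE prob_eq_1 by metis
  have s2: "(\<Sum>v\<in>B. (prob {v, - v})\<^sup>2) = 1 / N"
    using energy_axes[OF B AE, of \<alpha>] E by (simp add: N_def)
  have "(\<Sum>v\<in>B. (prob {v, - v} - 1 / N)\<^sup>2) =
      (\<Sum>v\<in>B. (prob {v, - v})\<^sup>2 - 2 / N * prob {v, - v} + 1 / N\<^sup>2)"
    by (rule sum.cong) (auto simp: power2_diff power_divide)
  also have "\<dots> = real (card B) / N\<^sup>2 - 1 / N"
    unfolding sum.distrib sum_subtractf s2 sum_distrib_left[symmetric] s1 by simp
  finally have eq: "(\<Sum>v\<in>B. (prob {v, - v} - 1 / N)\<^sup>2) = real (card B) / N\<^sup>2 - 1 / N" .
  have le: "real (card B) / N\<^sup>2 \<le> N / N\<^sup>2"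
    by (intro divide_right_mono) (use fin in \<open>auto simp: N_def\<close>)
  then have "real (card B) / N\<^sup>2 \<le> 1 / N" using N by (simp add: power2_eq_square)
  moreover have "0 \<le> (\<Sum>v\<in>B. (prob {v, - v} - 1 / N)\<^sup>2)" by (intro sum_nonneg) simp
  ultimately have z: "(\<Sum>v\<in>B. (prob {v, - v} - 1 / N)\<^sup>2) = 0" and c: "real (card B) / N\<^sup>2 = 1 / N"
    using eq by linarith+
  have "card B = CARD('n)" using c N by (simp add: field_simps power2_eq_square N_def)
  moreover have "\<forall>v\<in>B. prob {v, - v} = 1 / N"
    using z fin by (subst (asm) sum_nonneg_eq_0_iff) auto
  ultimately show ?thesis
    using B sphere_prob orthonormal_basis_iff by (auto simp: P_Delta_eq_def N_def)
qed

end

lemma sphere_probI: "\<mu> \<in> sphere_probs \<Longrightarrow> sphere_prob \<mu>"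
  by (simp add: sphere_prob_def sphere_prob_axioms_def sphere_probsD)

section \<open>The threshold exponent\<close>

lemma sphere_borel_measurable:
  "f \<in> borel \<rightarrow>\<^sub>M N \<Longrightarrow> f \<in> sphere_borel \<rightarrow>\<^sub>M N"
  by (rule measurable_restrict_space1)

lemma energy_distr:
  fixes X :: "'a \<Rightarrow> real ^ 'n::finite"
  assumes \<Omega>: "prob_space \<Omega>" and X [measurable]: "X \<in> \<Omega> \<rightarrow>\<^sub>M sphere_borel"
  shows "energy \<alpha> (distr \<Omega> sphere_borel X) = 1 / 2 * (LINT s|\<Omega>. LINT t|\<Omega>. kpow \<alpha> (X s) (X t))"
proof -
  interpret prob_space \<Omega> by fact
  have [measurable]: "X \<in> borel_measurable \<Omega>"
    using measurable_compose[OF X sphere_borel_measurable[of "\<lambda>x. x" borel]] by simp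
  interpret S: sphere_prob "distr \<Omega> sphere_borel X"
    by (intro sphere_probI distr_sphere_probs \<Omega> X)
  have inner: "(LINT y|distr \<Omega> sphere_borel X. kpow \<alpha> x y) = (LINT t|\<Omega>. kpow \<alpha> x (X t))" for x
    by (rule integral_distr[OF X]) (rule sphere_borel_measurable, measurable)
  have "(\<lambda>x. LINT t|\<Omega>. kpow \<alpha> x (X t)) \<in> borel_measurable (borel :: (real ^ 'n) measure)"
    by measurable
  then have "(\<lambda>x. LINT t|\<Omega>. kpow \<alpha> x (X t)) \<in> borel_measurable sphere_borel"
    by (rule sphere_borel_measurable)
  then show ?thesis
    unfolding S.energy_eq inner by (subst integral_distr[OF X]) auto
qed

text \<open>The kernel is jointly continuous in the points and the exponent. The limit exponent must
  be positive so that powers of a base tending to 0 still tend to 0.\<close>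

lemma tendsto_kpow:
  fixes x :: "real ^ 'n::finite"
  assumes "f \<longlonglongrightarrow> x" "g \<longlonglongrightarrow> y" "a \<longlonglongrightarrow> b" "0 < b"
  shows "(\<lambda>k. kpow (ereal (a k)) (f k) (g k)) \<longlonglongrightarrow> kpow (ereal b) x y"
  unfolding kpow_def using assms
  by (auto intro!: tendsto_powr' tendsto_clam always_eventually simp: clam_bounds)

text \<open>Dominated convergence in each variable, with majorant 1. Measures and exponents move
  together, so this serves both a fixed measure with varying exponent and the passage to the weak
  limit.\<close>

lemma tendsto_energy:
  fixes Y :: "'a \<Rightarrow> real ^ 'n::finite"
  assumes \<Omega>: "prob_space \<Omega>" and X: "\<And>k. X k \<in> \<Omega> \<rightarrow>\<^sub>M sphere_borel" and Y: "Y \<in> \<Omega> \<rightarrow>\<^sub>M sphere_borel"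
    and lim: "AE \<omega> in \<Omega>. (\<lambda>k. X k \<omega>) \<longlonglongrightarrow> Y \<omega>"
    and a: "\<And>k. 0 < a k" "a \<longlonglongrightarrow> b" "0 < b"
  shows "(\<lambda>k. energy (ereal (a k)) (distr \<Omega> sphere_borel (X k)))
    \<longlonglongrightarrow> energy (ereal b) (distr \<Omega> sphere_borel Y)"
proof -
  interpret prob_space \<Omega> by fact
  have m [measurable]: "Z \<in> borel_measurable \<Omega>" if "Z \<in> \<Omega> \<rightarrow>\<^sub>M sphere_borel" for Z :: "'a \<Rightarrow> real ^ 'n"
    using measurable_compose[OF that sphere_borel_measurable[of "\<lambda>x. x" borel]] by simp
  note [measurable] = m[OF X] m[OF Y]
  have bd: "\<bar>kpow (ereal (a k)) x y\<bar> \<le> 1" for k and x y :: "real ^ 'n"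
    using kpow_nonneg[of "ereal (a k)" x y] kpow_le_1[of "ereal (a k)" x y] a(1)[of k] by simp
  have int: "integrable \<Omega> (\<lambda>t. kpow (ereal (a k)) x (X k t))" for k x
    by (rule integrable_const_bound[of _ 1]) (auto simp: bd)
  have "AE s in \<Omega>. (\<lambda>k. LINT t|\<Omega>. kpow (ereal (a k)) (X k s) (X k t))
      \<longlonglongrightarrow> (LINT t|\<Omega>. kpow (ereal b) (Y s) (Y t))"
    using lim
  proof eventually_elim
    case (elim s)
    show ?case
    proof (rule integral_dominated_convergence[where w = "\<lambda>_. 1"])
      show "AE t in \<Omega>. (\<lambda>k. kpow (ereal (a k)) (X k s) (X k t)) \<longlonglongrightarrow> kpow (ereal b) (Y s) (Y t)"
        using lim by eventually_elim (rule tendsto_kpow[OF elim _ a(2,3)])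
      show "(\<lambda>t. kpow (ereal b) (Y s) (Y t)) \<in> borel_measurable \<Omega>" by measurable
      show "(\<lambda>t. kpow (ereal (a k)) (X k s) (X k t)) \<in> borel_measurable \<Omega>" for k by measurable
      show "AE t in \<Omega>. norm (kpow (ereal (a k)) (X k s) (X k t)) \<le> 1" for k using bd by simp
    qed simp
  qed
  then have "(\<lambda>k. LINT s|\<Omega>. LINT t|\<Omega>. kpow (ereal (a k)) (X k s) (X k t))
      \<longlonglongrightarrow> (LINT s|\<Omega>. LINT t|\<Omega>. kpow (ereal b) (Y s) (Y t))"
  proof (rule integral_dominated_convergence[where w = "\<lambda>_. 1", rotated 3])
    fix k
    have "\<bar>LINT t|\<Omega>. kpow (ereal (a k)) x (X k t)\<bar> \<le> 1" for x
    proof -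
      have "(LINT t|\<Omega>. kpow (ereal (a k)) x (X k t)) \<le> (LINT t|\<Omega>. 1)"
        using bd by (intro integral_mono int) (auto simp: abs_le_iff)
      moreover have "0 \<le> (LINT t|\<Omega>. kpow (ereal (a k)) x (X k t))"
        by (intro Bochner_Integration.integral_nonneg kpow_nonneg)
      ultimately show ?thesis by (simp add: prob_space)
    qed
    then show "AE s in \<Omega>. norm (LINT t|\<Omega>. kpow (ereal (a k)) (X k s) (X k t)) \<le> 1" by simp
    show "(\<lambda>s. LINT t|\<Omega>. kpow (ereal (a k)) (X k s) (X k t)) \<in> borel_measurable \<Omega>" by measurable
  next
    show "(\<lambda>s. LINT t|\<Omega>. kpow (ereal b) (Y s) (Y t)) \<in> borel_measurable \<Omega>" by measurable
  qed simp
  then show ?thesis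
    unfolding energy_distr[OF \<Omega> X] energy_distr[OF \<Omega> Y] by (intro tendsto_intros)
qed

section \<open>Uniform measures on finite families of points\<close>

definition uniform_on :: "('i::finite \<Rightarrow> real ^ 'n::finite) \<Rightarrow> (real ^ 'n) measure" where
  "uniform_on X = distr (measure_pmf (pmf_of_set UNIV)) sphere_borel X"

context
  fixes X :: "'i::finite \<Rightarrow> real ^ 'n::finite"
  assumes X: "\<And>i. norm (X i) = 1"
begin

lemma measurable_points: "X \<in> measure_pmf (pmf_of_set UNIV) \<rightarrow>\<^sub>M sphere_borel"
  using X by (simp add: measurable_pmf_measure1)

lemma uniform_on_sphere_probs: "uniform_on X \<in> sphere_probs"
  unfolding uniform_on_def
  by (intro distr_sphere_probs measurable_points measure_pmf.prob_space_axioms)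

lemma energy_uniform_on:
  "energy \<alpha> (uniform_on X) = 1 / 2 * ((\<Sum>i\<in>UNIV. \<Sum>j\<in>UNIV. kpow \<alpha> (X i) (X j)) / (real CARD('i))\<^sup>2)"
  unfolding uniform_on_def
  by (subst energy_distr[OF measure_pmf.prob_space_axioms measurable_points])
    (simp add: integral_pmf_of_set sum_divide_distrib power2_eq_square)

lemma AE_uniform_onD:
  assumes "AE x in uniform_on X. P x"
  shows "P (X i)"
  using AE_distrD[OF measurable_points assms[unfolded uniform_on_def]]
  by (simp add: AE_measure_pmf_iff)

lemma AE_uniform_onI:
  assumes "\<And>i. P (X i)" "{x \<in> sphere 0 1. P x} \<in> sets sphere_borel"
  shows "AE x in uniform_on X. P x"
  unfolding uniform_on_def using assms
  by (subst AE_distr_iff[OF measurable_points]) auto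

end

lemma orthonormal_standard: "orthonormal (range (\<lambda>i. axis i 1 :: real ^ 'n::finite))"
  by (auto simp: orthonormal_def pairwise_def orthogonal_def norm_axis_1 inner_axis_axis)

text \<open>The uniform measure on the standard basis is recognised by its energy at one exponent,
  here 1, instead of by the mass of each antipodal pair.\<close>

lemma P_Delta_eq_nonempty: "(P_Delta_eq :: (real ^ 'n::finite) measure set) \<noteq> {}"
proof -
  let ?X = "\<lambda>i. axis i 1 :: real ^ 'n"
  have X: "norm (?X i) = 1" for i by (simp add: norm_axis_1)
  interpret sphere_prob "uniform_on ?X"
    by (intro sphere_probI uniform_on_sphere_probs X)
  have "AE x in uniform_on ?X. x \<in> axes (range ?X)"
  proof (rule AE_uniform_onI[OF X])
    have "axes (range ?X) \<in> sets sphere_borel"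
      using prob_axes(2)[OF orthonormal_standard] sets_mu by simp
    moreover have "{x \<in> sphere 0 1. x \<in> axes (range ?X)} = axes (range ?X) \<inter> space sphere_borel"
      by auto
    ultimately show "{x \<in> sphere 0 1. x \<in> axes (range ?X)} \<in> sets sphere_borel"
      by (metis sets.Int sets.top)
  qed (auto simp: axes_def)
  moreover have "energy 1 (uniform_on ?X) = 1 / 2 * (1 - 1 / real CARD('n))"
  proof -
    have k: "kpow 1 (?X i) (?X j) = 1 - of_bool (i = j)" for i j
      using kpow_parallel[of "?X i" "?X j" 1] kpow_orthogonal[of "?X i" "?X j" 1]
      by (auto simp: inner_axis_axis)
    have "(\<Sum>i\<in>UNIV. \<Sum>j\<in>UNIV. kpow 1 (?X i) (?X j)) = (real CARD('n))\<^sup>2 - real CARD('n)"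
      unfolding k by (simp add: sum_subtractf of_bool_def power2_eq_square algebra_simps)
    then show ?thesis
      by (simp add: energy_uniform_on[OF X] field_simps power2_eq_square)
  qed
  ultimately show ?thesis using P_Delta_eqI[OF orthonormal_standard] by blast
qed

lemma axes_inner:
  assumes "orthonormal B" "x \<in> axes B" "y \<in> axes B"
  shows "x \<bullet> y = 0 \<or> \<bar>x \<bullet> y\<bar> = 1"
  using assms(2,3) orthonormal_inner[OF assms(1)] by (auto simp: axes_def split: if_splits)

text \<open>The witness is the mean of the uniform measures on two orthonormal bases that differ by a
  rotation by 45 degrees in one coordinate plane.\<close>

lemma exists_mixture_of_bases:
  assumes "CARD('n::finite) \<ge> 2"
  shows "\<exists>\<mu> :: (real ^ 'n) measure. \<mu> \<in> sphere_probs - P_Delta_eq \<and>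
    (\<forall>\<alpha>>0. energy (ereal \<alpha>) \<mu> =
       1 / 2 * (1 - 1 / real CARD('n) + (2 powr (1 - \<alpha>) - 1) / (real CARD('n))\<^sup>2))"
proof -
  obtain a b :: 'n where ab: "a \<noteq> b"
    using assms by (metis card_2_iff' card_le_Suc0_iff_eq finite not_less_eq_eq numeral_2_eq_2 UNIV_I)
  define c where "c = 1 / sqrt 2"
  have c: "c * c = 1 / 2" "c > 0" by (auto simp: c_def)
  define e where "e i = (axis i 1 :: real ^ 'n)" for i
  have ee: "e i \<bullet> e j = of_bool (i = j)" for i j by (simp add: e_def inner_axis_axis)
  \<comment> \<open>The boolean selects the basis. The two bases share all vectors outside the
    rotated plane; these points are repeated in the family and so get double weight.\<close>
  define X where "X p = (if snd p \<and> fst p = a then c *\<^sub>R (e a + e b)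
    else if snd p \<and> fst p = b then c *\<^sub>R (e a - e b) else e (fst p))" for p :: "'n \<times> bool"
  define AB where "AB = {a, b}"
  have inner: "\<bar>X p \<bullet> X q\<bar> = (if snd p \<noteq> snd q \<and> fst p \<in> AB \<and> fst q \<in> AB then c
      else of_bool (fst p = fst q))" for p q
    using ab c by (cases p; cases q)
      (auto simp: X_def AB_def ee inner_add_left inner_add_right inner_diff_left inner_diff_right
        algebra_simps of_bool_def)
  have X: "norm (X p) = 1" for p
  proof -
    have "\<bar>X p \<bullet> X p\<bar> = 1" unfolding inner by simp
    then show ?thesis by (simp add: norm_eq_1 abs_if split: if_splits) (smt (verit) inner_ge_zero)
  qed
  interpret sphere_prob "uniform_on X"
    by (intro sphere_probI uniform_on_sphere_probs X)
  have "uniform_on X \<notin> P_Delta_eq"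
  proof
    assume "uniform_on X \<in> P_Delta_eq"
    then obtain B where "orthonormal_basis B" and AE: "AE x in uniform_on X. x \<in> axes B"
      using P_Delta_eqD by blast
    then have "orthonormal B" by (simp add: orthonormal_basis_iff)
    from axes_inner[OF this AE_uniform_onD[OF X AE] AE_uniform_onD[OF X AE], of "(a, False)" "(a, True)"]
    have "\<bar>X (a, False) \<bullet> X (a, True)\<bar> = 0 \<or> \<bar>X (a, False) \<bullet> X (a, True)\<bar> = 1" by auto
    then show False using c unfolding inner by (auto simp: AB_def)
  qed
  moreover have "energy (ereal \<alpha>) (uniform_on X) =
       1 / 2 * (1 - 1 / real CARD('n) + (2 powr (1 - \<alpha>) - 1) / (real CARD('n))\<^sup>2)" if "\<alpha> > 0" for \<alpha>
  proof -
    define h where "h = 1 - 2 powr (- \<alpha>)"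
    define N where "N = real CARD('n)"
    have N: "N > 0" by (simp add: N_def)
    \<comment> \<open>Here h is what a pair at 45 degrees loses. The last term changes the kernel
      only for points of different bases that both lie in the rotated plane, and its product form
      lets the double sum be evaluated row by row.\<close>
    have k: "kpow (ereal \<alpha>) (X p) (X q) = 1 - of_bool (fst p = fst q) -
        of_bool (snd p \<noteq> snd q) * (of_bool (fst p \<in> AB) * (of_bool (fst q \<in> AB) * h - of_bool (fst p = fst q)))" for p q
    proof (cases "snd p \<noteq> snd q \<and> fst p \<in> AB \<and> fst q \<in> AB")
      case True
      then have "\<bar>X p \<bullet> X q\<bar> = 1 / sqrt 2" unfolding inner by (simp add: c_def)
      then have half: "clam (X p) (X q) = 1 / 2"
        by (simp add: clam_def min_absorb2 arcsin_one_over_sqrt_2)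
      have "kpow (ereal \<alpha>) (X p) (X q) = clam (X p) (X q) powr \<alpha>" by (simp add: kpow_def)
      also have "\<dots> = 2 powr (- \<alpha>)" unfolding half by (simp add: powr_divide powr_minus_divide)
      finally show ?thesis using True by (simp add: h_def)
    next
      case False
      then have "\<bar>X p \<bullet> X q\<bar> = of_bool (fst p = fst q)" unfolding inner by (rule if_not_P)
      then show ?thesis
        using False kpow_parallel[of "X p" "X q"] kpow_orthogonal[of "X p" "X q"]
        by (cases "fst p = fst q") auto
    qed
    have cAB: "(\<Sum>j\<in>UNIV. of_bool (j \<in> AB) :: real) = 2"
    proof -
      have "card AB = 2" using ab by (simp add: AB_def)
      then show ?thesis by (simp add: of_bool_def sum.If_cases)
    qed
    have row: "(\<Sum>j\<in>UNIV. 1 - of_bool (i = j) - d * (of_bool (i \<in> AB) * (of_bool (j \<in> AB) * h - of_bool (i = j))))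
        = N - 1 - d * (of_bool (i \<in> AB) * (2 * h - 1))" for i d
    proof -
      have "(\<Sum>j\<in>UNIV. of_bool (i = j) :: real) = 1" by (simp add: of_bool_def)
      then show ?thesis
        by (simp add: sum_subtractf sum_distrib_left[symmetric] sum_distrib_right[symmetric] cAB N_def)
    qed
    have block: "(\<Sum>i\<in>UNIV. N - 1 - d * (of_bool (i \<in> AB) * (2 * h - 1)))
        = N * N - N - 2 * d * (2 * h - 1)" for d
    proof -
      have "(\<Sum>i\<in>UNIV. N - 1 - d * (of_bool (i \<in> AB) * (2 * h - 1)))
          = N * (N - 1) - d * (2 * (2 * h - 1))"
        by (simp add: sum_subtractf sum_distrib_left[symmetric] sum_distrib_right[symmetric] cAB N_def)
      then show ?thesis by (simp add: algebra_simps)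
    qed
    have "(\<Sum>p\<in>UNIV. \<Sum>q\<in>UNIV. kpow (ereal \<alpha>) (X p) (X q)) =
       (\<Sum>s\<in>UNIV. \<Sum>t\<in>UNIV. \<Sum>i\<in>UNIV. \<Sum>j\<in>UNIV. kpow (ereal \<alpha>) (X (i, s)) (X (j, t)))"
    proof -
      have split: "(\<Sum>p\<in>UNIV. F p) = (\<Sum>s\<in>UNIV. \<Sum>i\<in>UNIV. F (i, s))" for F :: "'n \<times> bool \<Rightarrow> real"
        by (subst sum.swap) (simp add: sum.cartesian_product UNIV_Times_UNIV[symmetric] del: UNIV_Times_UNIV)
      show ?thesis unfolding split by (intro sum.cong refl sum.swap)
    qed
    also have "\<dots> = (\<Sum>s\<in>(UNIV :: bool set). \<Sum>t\<in>UNIV. N * N - N - 2 * of_bool (s \<noteq> t) * (2 * h - 1))"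
      unfolding k fst_conv snd_conv row block by (rule refl)
    \<comment> \<open>Four blocks of \<open>N * N - N\<close>, of which the two mixed ones are
      corrected by \<open>2 * (2 * h - 1)\<close> each.\<close>
    also have "\<dots> = 4 * (N * N - N) - 4 * (2 * h - 1)"
      by (simp add: UNIV_bool algebra_simps)
    finally have S: "(\<Sum>p\<in>UNIV. \<Sum>q\<in>UNIV. kpow (ereal \<alpha>) (X p) (X q)) = 4 * (N * N - N) - 4 * (2 * h - 1)" .
    define P where "P = 2 powr (1 - \<alpha>) - 1"
    have hP: "2 * h - 1 = - P"
      unfolding P_def using powr_add[of 2 1 "- \<alpha>"] by (simp add: h_def)
    show ?thesis
      unfolding energy_uniform_on[OF X] S hP P_def[symmetric] using N
      by (simp add: N_def[symmetric] field_simps power2_eq_square)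
  qed
  ultimately show ?thesis using sphere_prob by blast
qed

section \<open>Exponents at which the energy is bounded by its value on the orthonormal axes\<close>

definition delta_exponents :: "'n::finite itself \<Rightarrow> ereal set" where
  "delta_exponents _ = {\<alpha>. 0 < \<alpha> \<and>
     (\<forall>\<mu> \<in> (sphere_probs :: (real ^ 'n) measure set). energy \<alpha> \<mu> \<le> 1 / 2 * (1 - 1 / real CARD('n)))}"

lemma P_Delta_eq_subset_argmax:
  assumes "\<alpha> \<in> delta_exponents TYPE('n::finite)"
  shows "(P_Delta_eq :: (real ^ 'n) measure set) \<subseteq> energy_argmax \<alpha>"
proof
  fix \<mu> :: "(real ^ 'n) measure"
  assume \<mu>: "\<mu> \<in> P_Delta_eq"
  then have s: "\<mu> \<in> sphere_probs" by (simp add: P_Delta_eq_def)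
  show "\<mu> \<in> energy_argmax \<alpha>"
    using assms s sphere_prob.energy_P_Delta_eq[OF sphere_probI[OF s] \<mu>, of \<alpha>]
    by (auto simp: energy_argmax_def is_arg_max_def delta_exponents_def not_less)
qed

lemma argmax_imp_delta_exponents:
  assumes "\<mu> \<in> (P_Delta_eq :: (real ^ 'n::finite) measure set)" "\<mu> \<in> energy_argmax \<alpha>" "0 < \<alpha>"
  shows "\<alpha> \<in> delta_exponents TYPE('n)"
proof -
  have s: "\<mu> \<in> sphere_probs" using assms(1) by (simp add: P_Delta_eq_def)
  show ?thesis
    using assms(2,3) sphere_prob.energy_P_Delta_eq[OF sphere_probI[OF s] assms(1), of \<alpha>]
    by (auto simp: energy_argmax_def is_arg_max_def delta_exponents_def not_less)
qed

text \<open>The bound is inherited by larger exponents because the energy decreases while the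
  right-hand side stays fixed. This is why the set is defined by a bound rather than by
  maximizers.\<close>

lemma delta_exponents_mono:
  assumes "\<alpha> \<in> delta_exponents TYPE('n::finite)" "\<alpha> \<le> \<beta>"
  shows "\<beta> \<in> delta_exponents TYPE('n)"
proof -
  have "0 < \<alpha>" using assms by (simp add: delta_exponents_def)
  moreover from this have "0 < \<beta>" using assms(2) by order
  ultimately show ?thesis
    using assms sphere_prob.energy_antimono[OF sphere_probI, of _ \<alpha> \<beta>]
    by (fastforce simp: delta_exponents_def)
qed

lemma P_Delta_eq_eq_argmax:
  assumes "\<alpha> \<in> delta_exponents TYPE('n::finite)" "\<alpha> < \<beta>"
  shows "(P_Delta_eq :: (real ^ 'n) measure set) = energy_argmax \<beta>"
proof (intro equalityI subsetI)
  have \<beta>: "\<beta> \<in> delta_exponents TYPE('n)" using delta_exponents_mono assms by (metis less_imp_le)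
  then show "\<mu> \<in> energy_argmax \<beta>" if "\<mu> \<in> P_Delta_eq" for \<mu> :: "(real ^ 'n) measure"
    using P_Delta_eq_subset_argmax that by blast
  fix \<mu> :: "(real ^ 'n) measure"
  assume \<mu>: "\<mu> \<in> energy_argmax \<beta>"
  then have s: "\<mu> \<in> sphere_probs" by (simp add: energy_argmax_def is_arg_max_def)
  then interpret sphere_prob \<mu> by (rule sphere_probI)
  obtain \<nu> :: "(real ^ 'n) measure" where \<nu>: "\<nu> \<in> P_Delta_eq" using P_Delta_eq_nonempty by blast
  then have "\<nu> \<in> sphere_probs" by (simp add: P_Delta_eq_def)
  then have "energy \<beta> \<nu> = 1 / 2 * (1 - 1 / real CARD('n))" "energy \<beta> \<nu> \<le> energy \<beta> \<mu>"
    using sphere_prob.energy_P_Delta_eq[OF sphere_probI \<nu>] \<mu>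
    by (auto simp: energy_argmax_def is_arg_max_def not_less)
  moreover have "0 < \<alpha>" "energy \<alpha> \<mu> \<le> 1 / 2 * (1 - 1 / real CARD('n))"
    using assms(1) s by (auto simp: delta_exponents_def)
  moreover have "energy \<beta> \<mu> \<le> energy \<alpha> \<mu>"
    using energy_antimono assms(2) \<open>0 < \<alpha>\<close> by simp
  \<comment> \<open>The energies at \<beta> and \<alpha> are squeezed between two copies of the
    common value.\<close>
  ultimately have E: "energy \<beta> \<mu> = energy \<alpha> \<mu>" "energy \<beta> \<mu> = 1 / 2 * (1 - 1 / real CARD('n))"
    by linarith+
  show "\<mu> \<in> P_Delta_eq"
    using AE_axes_of_right_angles[OF energy_eq_imp_AE[OF \<open>0 < \<alpha>\<close> \<open>\<alpha> < \<beta>\<close> E(1)]] P_Delta_eqI E(2)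
    by blast
qed

text \<open>Below exponent 1 the excess \<open>2 powr (1 - a) - 1\<close> of the mixture of two
  bases is positive, so the bound fails there.\<close>

lemma delta_exponents_ge_1:
  assumes "CARD('n::finite) \<ge> 2" "\<alpha> \<in> delta_exponents TYPE('n)"
  shows "1 \<le> \<alpha>"
proof (rule ccontr)
  assume "\<not> 1 \<le> \<alpha>"
  moreover have "0 < \<alpha>" using assms by (simp add: delta_exponents_def)
  ultimately obtain a where a: "\<alpha> = ereal a" "0 < a" "a < 1" by (cases \<alpha>) auto
  obtain \<mu> :: "(real ^ 'n) measure" where "\<mu> \<in> sphere_probs" and
    E: "energy (ereal a) \<mu> = 1 / 2 * (1 - 1 / real CARD('n) + (2 powr (1 - a) - 1) / (real CARD('n))\<^sup>2)"
    using exists_mixture_of_bases[OF assms(1)] a(2) by blast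
  then have "(2 powr (1 - a) - 1) / (real CARD('n))\<^sup>2 \<le> 0"
    using assms(2) a by (auto simp: delta_exponents_def)
  moreover have "2 powr (1 - a) > 1" using a by (intro gr_one_powr) auto
  ultimately show False by (simp add: divide_le_0_iff)
qed

text \<open>Since the threshold is defined by \<open>THE\<close>, its existence and uniqueness are part of the claim.\<close>

lemma threshold_exponent_eq_Inf:
  assumes "CARD('n::finite) \<ge> 2"
  shows "threshold_exponent TYPE('n) = Inf (delta_exponents TYPE('n))"
  unfolding threshold_exponent_def
proof (rule the_equality)
  let ?S = "delta_exponents TYPE('n)"
  show thr: "is_threshold_exponent TYPE('n) (Inf ?S)"
    unfolding is_threshold_exponent_def
  proof (intro conjI allI impI)
    show "1 \<le> Inf ?S" using delta_exponents_ge_1[OF assms] by (rule Inf_greatest)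
  next
    fix \<alpha> assume \<alpha>: "0 < \<alpha> \<and> \<alpha> < Inf ?S"
    then have "\<alpha> \<notin> ?S" using Inf_lower[of \<alpha> ?S] by auto
    then show "(P_Delta_eq :: (real ^ 'n) measure set) \<inter> energy_argmax \<alpha> = {}"
      using argmax_imp_delta_exponents \<alpha> by blast
  next
    fix \<alpha> assume "Inf ?S < \<alpha>"
    then show "(P_Delta_eq :: (real ^ 'n) measure set) = energy_argmax \<alpha>"
      using P_Delta_eq_eq_argmax by (auto simp: Inf_less_iff)
  qed
  \<comment> \<open>At an exponent strictly between two thresholds, the nonempty set
    \<open>P_Delta_eq\<close> would both equal the set of maximizers and be disjoint from
    it.\<close>
  have no_lt: "\<not> a < b" if "is_threshold_exponent TYPE('n) a" "is_threshold_exponent TYPE('n) b" for a b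
  proof
    assume "a < b"
    then obtain \<alpha> where \<alpha>: "a < \<alpha>" "\<alpha> < b" using dense by blast
    have "1 \<le> a" using that(1) by (simp add: is_threshold_exponent_def)
    then have "0 < a" by (rule less_le_trans[rotated]) simp
    then have "0 < \<alpha>" using \<alpha>(1) by order
    then have "(P_Delta_eq :: (real ^ 'n) measure set) \<inter> energy_argmax \<alpha> = {}"
      using that(2) \<alpha>(2) by (simp add: is_threshold_exponent_def)
    moreover have "(P_Delta_eq :: (real ^ 'n) measure set) = energy_argmax \<alpha>"
      using that(1) \<alpha>(1) by (simp add: is_threshold_exponent_def)
    ultimately show False using P_Delta_eq_nonempty[where 'n = 'n] by simp
  qed
  show "a = Inf ?S" if "is_threshold_exponent TYPE('n) a" for a
    using no_lt[OF that thr] no_lt[OF thr that] by order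
qed

lemma Inf_delta_exponents_mem:
  assumes "CARD('n::finite) \<ge> 2" "Inf (delta_exponents TYPE('n)) = ereal a"
  shows "ereal a \<in> delta_exponents TYPE('n)" "1 \<le> a"
proof -
  have "1 \<le> Inf (delta_exponents TYPE('n))"
    using delta_exponents_ge_1[OF assms(1)] by (rule Inf_greatest)
  then show a: "1 \<le> a" using assms(2) by simp
  define b where "b k = a + inverse (real (Suc k))" for k
  have b: "b \<longlonglongrightarrow> a"
    using tendsto_add[OF tendsto_const LIMSEQ_inverse_real_of_nat, of a] by (simp add: b_def[abs_def])
  have b_gt: "a < b k" for k by (simp add: b_def)
  have "energy (ereal a) \<mu> \<le> 1 / 2 * (1 - 1 / real CARD('n))"
    if \<mu>: "\<mu> \<in> sphere_probs" for \<mu> :: "(real ^ 'n) measure"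
  proof -
    interpret sphere_prob \<mu> using \<mu> by (rule sphere_probI)
    \<comment> \<open>The coupling is constant, the identity on \<mu>, so that only the exponent
      varies.\<close>
    have id: "(\<lambda>x. x) \<in> \<mu> \<rightarrow>\<^sub>M sphere_borel" by (rule measurable_ident_sets[OF sets_mu])
    have "distr \<mu> sphere_borel (\<lambda>x. x) = distr \<mu> \<mu> (\<lambda>x. x)" by (rule distr_cong) (simp_all add: sets_mu)
    then have d: "distr \<mu> sphere_borel (\<lambda>x. x) = \<mu>" by (simp add: distr_id)
    have "(\<lambda>k. energy (ereal (b k)) \<mu>) \<longlonglongrightarrow> energy (ereal a) \<mu>"
      using tendsto_energy[OF prob_space_axioms id id _ _ b] a b_gt unfolding d
      by (smt (verit) AE_I2 tendsto_const)
    moreover have "energy (ereal (b k)) \<mu> \<le> 1 / 2 * (1 - 1 / real CARD('n))" for k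
    proof -
      have "Inf (delta_exponents TYPE('n)) < ereal (b k)" using assms(2) b_gt by simp
      then obtain \<alpha> where "\<alpha> \<in> delta_exponents TYPE('n)" "\<alpha> < ereal (b k)" by (auto simp: Inf_less_iff)
      then have "ereal (b k) \<in> delta_exponents TYPE('n)" using delta_exponents_mono less_imp_le by blast
      then show ?thesis using \<mu> by (simp add: delta_exponents_def)
    qed
    ultimately show ?thesis by (intro LIMSEQ_le_const2) auto
  qed
  then show "ereal a \<in> delta_exponents TYPE('n)" using a by (simp add: delta_exponents_def)
qed

section \<open>Measures near orthogonal axes\<close>

text \<open>The square of sin (a + b) exceeds the sum of the squares of sin a and sin b by 2 sin a
  sin b cos (a + b), which is nonnegative up to a right angle.\<close>

lemma sum_sin_squared_le:
  assumes "finite I" "\<And>i. i \<in> I \<Longrightarrow> 0 \<le> \<phi> i" "(\<Sum>i\<in>I. \<phi> i) \<le> pi / 2"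
  shows "(\<Sum>i\<in>I. (sin (\<phi> i))\<^sup>2) \<le> (sin (\<Sum>i\<in>I. \<phi> i))\<^sup>2"
  using assms
proof (induction I rule: finite_induct)
  case (insert i I)
  define a b where "a = \<phi> i" and "b = (\<Sum>i\<in>I. \<phi> i)"
  have ab: "0 \<le> a" "0 \<le> b" "a + b \<le> pi / 2"
    using insert by (auto simp: a_def b_def intro!: sum_nonneg)
  have "(sin (a + b))\<^sup>2 - (sin a)\<^sup>2 - (sin b)\<^sup>2 = 2 * sin a * sin b * cos (a + b)"
  proof -
    have "(cos a)\<^sup>2 = 1 - (sin a)\<^sup>2" "(cos b)\<^sup>2 = 1 - (sin b)\<^sup>2" by (simp_all add: cos_squared_eq)
    then show ?thesis
      by (simp add: sin_add cos_add power2_sum power_mult_distrib) (simp add: power2_eq_square algebra_simps)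
  qed
  moreover have "0 \<le> 2 * sin a * sin b * cos (a + b)"
    using ab pi_gt_zero by (intro mult_nonneg_nonneg sin_ge_zero cos_ge_zero) linarith+
  moreover have "(\<Sum>i\<in>I. (sin (\<phi> i))\<^sup>2) \<le> (sin b)\<^sup>2"
    using insert ab unfolding b_def[symmetric] by (auto simp: a_def)
  ultimately show ?case using insert by (simp add: a_def b_def)
qed simp

text \<open>The angles between \<open>x\<close> and the coordinate hyperplanes sum to at least a right angle, because
  their squared sines sum to 1 and squared sines are superadditive below a right angle.\<close>

lemma sum_clam_basis_le:
  fixes x :: "real ^ 'n::finite"
  assumes B: "orthonormal_basis B" and x: "norm x = 1"
  shows "(\<Sum>v\<in>B. clam x v) \<le> real CARD('n) - 1"
proof -
  have o: "orthonormal B" "card B = CARD('n)" "finite B"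
    using B orthonormal_basis_iff orthonormal_finite by auto
  have le1: "\<bar>x \<bullet> v\<bar> \<le> 1" if "v \<in> B" for v
    using abs_inner_unit_le[OF x] o(1) that by (auto simp: orthonormal_def)
  define \<phi> where "\<phi> v = arcsin \<bar>x \<bullet> v\<bar>" for v
  have \<phi>: "0 \<le> \<phi> v" "sin (\<phi> v) = \<bar>x \<bullet> v\<bar>" "clam x v = 1 - 2 / pi * \<phi> v" if "v \<in> B" for v
    using le1[OF that] by (auto simp: \<phi>_def arcsin_nonneg clam_def min_absorb2)
  have "pi / 2 \<le> (\<Sum>v\<in>B. \<phi> v)"
  proof (rule ccontr)
    assume small: "\<not> pi / 2 \<le> (\<Sum>v\<in>B. \<phi> v)"
    have nn: "0 \<le> (\<Sum>v\<in>B. \<phi> v)" using \<phi>(1) by (rule sum_nonneg)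
    have "1 = (\<Sum>v\<in>B. (x \<bullet> v)\<^sup>2)" using orthonormal_basis_Parseval[OF B, of x] x by simp
    also have "\<dots> = (\<Sum>v\<in>B. (sin (\<phi> v))\<^sup>2)" by (rule sum.cong) (auto simp: \<phi>(2))
    also have "\<dots> \<le> (sin (\<Sum>v\<in>B. \<phi> v))\<^sup>2"
      using small \<phi>(1) o(3) by (intro sum_sin_squared_le) auto
    also have "\<dots> < 1"
    proof -
      have "sin (\<Sum>v\<in>B. \<phi> v) < sin (pi / 2)"
        using small nn by (intro sin_monotone_2pi) auto
      moreover have "0 \<le> sin (\<Sum>v\<in>B. \<phi> v)" using small nn by (intro sin_ge_zero) auto
      ultimately show ?thesis by (simp add: abs_square_less_1)
    qed
    finally show False by simp
  qed
  then have "1 \<le> 2 / pi * (\<Sum>v\<in>B. \<phi> v)" by (simp add: field_simps)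
  moreover have "(\<Sum>v\<in>B. clam x v) = (\<Sum>v\<in>B. 1 - 2 / pi * \<phi> v)" by (rule sum.cong) (auto simp: \<phi>(3))
  ultimately show ?thesis using o by (simp add: sum_subtractf sum_distrib_left)
qed

text \<open>For unit vectors the squared length of x - v is \<open>2 - 2 * (x \<bullet> v)\<close>,
  so this is the set of unit vectors x with x or -x at distance less than \<epsilon> from v (for
  unit v and \<epsilon> > 0).\<close>

definition cell :: "real \<Rightarrow> real ^ 'n::finite \<Rightarrow> (real ^ 'n) set" where
  "cell \<epsilon> v = {x. norm x = 1 \<and> 1 - \<epsilon>\<^sup>2 / 2 < \<bar>x \<bullet> v\<bar>}"

lemma cell_signed:
  assumes "x \<in> cell \<epsilon> v" "norm v = 1" "0 \<le> \<epsilon>"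
  shows "\<exists>\<sigma>\<in>{1, -1}. norm (\<sigma> *\<^sub>R x - v) < \<epsilon>"
proof -
  obtain \<sigma> :: real where \<sigma>: "\<sigma> \<in> {1, -1}" "\<bar>x \<bullet> v\<bar> = \<sigma> * (x \<bullet> v)"
    by (cases "x \<bullet> v \<ge> 0") (auto intro: that[of 1] that[of "-1"])
  have "(norm (\<sigma> *\<^sub>R x - v))\<^sup>2 = 2 - 2 * \<bar>x \<bullet> v\<bar>"
    using assms \<sigma> unfolding power2_norm_eq_inner
    by (auto simp: cell_def norm_eq_1 inner_diff inner_commute inner_add)
  also have "\<dots> < \<epsilon>\<^sup>2" using assms by (simp add: cell_def)
  finally show ?thesis using \<sigma>(1) assms(3) power2_less_imp_less by blast
qed

lemma clam_sign: "\<sigma> \<in> {1, -1 :: real} \<Longrightarrow> \<tau> \<in> {1, -1} \<Longrightarrow> clam (\<sigma> *\<^sub>R x) (\<tau> *\<^sub>R y) = clam x y"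
  by (auto simp: clam_def)

text \<open>Two points near the same axis can only be far apart if the hyperplanes orthogonal to the
  representatives of the other cells separate them.\<close>

lemma clam_same_cell:
  fixes B :: "(real ^ 'n::finite) set"
  assumes B: "orthonormal_basis B" and v: "v \<in> B" and x: "x \<in> cell \<epsilon> v" and x': "x' \<in> cell \<epsilon> v"
    and y: "\<And>w. w \<in> B - {v} \<Longrightarrow> y w \<in> cell \<epsilon> w" and \<epsilon>: "0 \<le> \<epsilon>" "real CARD('n) * \<epsilon> \<le> 1 / 2"
  shows "clam x x' \<le> 2 * \<epsilon>"
    and "clam x x' \<le> pi * (\<Sum>w\<in>B - {v}. (1 - clam x (y w)) + (1 - clam x' (y w)))"
proof -
  have o: "orthonormal B" "card B = CARD('n)" "finite B"
    using B orthonormal_basis_iff orthonormal_finite by auto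
  have unit: "norm w = 1" if "w \<in> B" for w using o(1) that by (simp add: orthonormal_def)
  obtain \<sigma> :: real where \<sigma>: "\<sigma> \<in> {1, -1}" "norm (\<sigma> *\<^sub>R x - v) < \<epsilon>"
    using cell_signed[OF x unit[OF v] \<epsilon>(1)] by blast
  obtain \<tau> :: real where \<tau>: "\<tau> \<in> {1, -1}" "norm (\<tau> *\<^sub>R x' - v) < \<epsilon>"
    using cell_signed[OF x' unit[OF v] \<epsilon>(1)] by blast
  define p q where "p = \<sigma> *\<^sub>R x" and "q = \<tau> *\<^sub>R x'"
  define z where "z = p - q"
  have nx: "norm x = 1" "norm x' = 1" using x x' by (auto simp: cell_def)
  then have pq: "norm p = 1" "norm q = 1" using \<sigma>(1) \<tau>(1) by (auto simp: p_def q_def)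
  have c: "clam x x' \<le> norm z"
    using clam_le_dist[OF pq] clam_sign[OF \<sigma>(1) \<tau>(1), of x x'] by (simp add: p_def q_def z_def)
  have "norm z \<le> norm (p - v) + norm (q - v)"
    using norm_triangle_ineq4[of "p - v" "q - v"] by (simp add: z_def)
  then show "clam x x' \<le> 2 * \<epsilon>" using c \<sigma>(2) \<tau>(2) by (simp add: p_def q_def)
  \<comment> \<open>As p and q are unit vectors, z is orthogonal to p + q; its component along v
    comes only from the deviation of v from p and q.\<close>
  have zv: "\<bar>z \<bullet> v\<bar> \<le> \<epsilon> * norm z"
  proof -
    have "z \<bullet> (p + q) = 0"
      using pq by (simp add: z_def inner_diff_left inner_add_right norm_eq_1 inner_commute[of q p])
    moreover have "z \<bullet> ((v - p) + (v - q)) = (z \<bullet> v - z \<bullet> p) + (z \<bullet> v - z \<bullet> q)"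
      by (simp only: inner_add_right inner_diff_right)
    ultimately have "2 * (z \<bullet> v) = z \<bullet> ((v - p) + (v - q))" by (simp add: inner_add_right)
    then have "\<bar>2 * (z \<bullet> v)\<bar> \<le> norm z * norm ((v - p) + (v - q))" by (metis Cauchy_Schwarz_ineq2)
    also have "\<dots> \<le> norm z * (2 * \<epsilon>)"
      using \<sigma>(2) \<tau>(2) norm_triangle_ineq[of "v - p" "v - q"]
      by (intro mult_left_mono) (auto simp: p_def q_def norm_minus_commute)
    finally show ?thesis by (simp add: abs_mult mult.commute)
  qed
  \<comment> \<open>Replacing the axis w by the representative of its cell, up to sign, costs at
    most \<open>\<epsilon> * norm z\<close>.\<close>
  have zw: "\<bar>z \<bullet> w\<bar> \<le> \<bar>x \<bullet> y w\<bar> + \<bar>x' \<bullet> y w\<bar> + \<epsilon> * norm z" if w: "w \<in> B - {v}" for w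
  proof -
    obtain \<rho> :: real where \<rho>: "\<rho> \<in> {1, -1}" "norm (\<rho> *\<^sub>R y w - w) < \<epsilon>"
      using cell_signed[OF y[OF w] unit \<epsilon>(1)] w by blast
    have "z \<bullet> w = \<rho> * (z \<bullet> y w) - z \<bullet> (\<rho> *\<^sub>R y w - w)" by (simp add: inner_diff_right)
    also have "\<bar>\<dots>\<bar> \<le> \<bar>\<rho> * (z \<bullet> y w)\<bar> + \<bar>z \<bullet> (\<rho> *\<^sub>R y w - w)\<bar>" by (rule abs_triangle_ineq4)
    finally have "\<bar>z \<bullet> w\<bar> \<le> \<bar>z \<bullet> y w\<bar> + \<bar>z \<bullet> (\<rho> *\<^sub>R y w - w)\<bar>" using \<rho>(1) by (auto simp: abs_mult)
    moreover have "\<bar>z \<bullet> y w\<bar> \<le> \<bar>x \<bullet> y w\<bar> + \<bar>x' \<bullet> y w\<bar>"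
      using \<sigma>(1) \<tau>(1) by (auto simp: z_def p_def q_def inner_diff_left inner_add_left)
    moreover have "\<bar>z \<bullet> (\<rho> *\<^sub>R y w - w)\<bar> \<le> norm z * \<epsilon>"
      using Cauchy_Schwarz_ineq2[of z "\<rho> *\<^sub>R y w - w"] \<rho>(2)
      by (smt (verit) mult_left_mono norm_ge_zero)
    ultimately show ?thesis by (simp add: mult.commute)
  qed
  define S where "S = (\<Sum>w\<in>B - {v}. \<bar>x \<bullet> y w\<bar> + \<bar>x' \<bullet> y w\<bar>)"
  have "norm z = norm (\<Sum>w\<in>B. (z \<bullet> w) *\<^sub>R w)"
    using orthonormal_basis_expand[of B z] B o by (auto simp: orthonormal_basis_def)
  also have "\<dots> \<le> (\<Sum>w\<in>B. \<bar>z \<bullet> w\<bar>)"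
    by (rule sum_norm_le) (simp add: unit)
  also have "\<dots> = \<bar>z \<bullet> v\<bar> + (\<Sum>w\<in>B - {v}. \<bar>z \<bullet> w\<bar>)"
    using o(3) v by (rule sum.remove)
  also have "\<dots> \<le> \<epsilon> * norm z + (\<Sum>w\<in>B - {v}. (\<bar>x \<bullet> y w\<bar> + \<bar>x' \<bullet> y w\<bar>) + \<epsilon> * norm z)"
    by (intro add_mono zv sum_mono zw)
  also have "\<dots> = S + (1 + real (card (B - {v}))) * (\<epsilon> * norm z)"
    unfolding sum.distrib[of _ "\<lambda>_. \<epsilon> * norm z"] by (simp add: S_def[symmetric] algebra_simps)
  also have "1 + real (card (B - {v})) = real CARD('n)"
    using o v by (simp add: card_Diff_singleton card_gt_0_iff Suc_leI of_nat_diff)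
  \<comment> \<open>The N coordinate errors together are at most half of \<open>norm z\<close> and
    are absorbed on the left; this is the purpose of the bound on \<epsilon>.\<close>
  also have "real CARD('n) * (\<epsilon> * norm z) \<le> 1 / 2 * norm z"
    using mult_right_mono[OF \<epsilon>(2), of "norm z"] by (simp add: mult.assoc)
  finally have "norm z \<le> 2 * S" by simp
  also have "S \<le> (\<Sum>w\<in>B - {v}. pi / 2 * (1 - clam x (y w)) + pi / 2 * (1 - clam x' (y w)))"
    unfolding S_def using y by (intro sum_mono add_mono abs_inner_le_clam nx) (auto simp: cell_def)
  also have "2 * \<dots> = pi * (\<Sum>w\<in>B - {v}. (1 - clam x (y w)) + (1 - clam x' (y w)))"
    by (simp add: sum_distrib_left algebra_simps)
  finally show "clam x x' \<le> pi * (\<Sum>w\<in>B - {v}. (1 - clam x (y w)) + (1 - clam x' (y w)))"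
    using c by simp
qed

text \<open>Off the axes, Parseval gives some v with nonzero inner product, and its modulus is below
  1. There the base lies strictly between 0 and 1, so an exponent above 1 makes the bound for
  exponent 1 strict.\<close>

lemma sum_clam_powr_basis_less:
  fixes x :: "real ^ 'n::finite"
  assumes B: "orthonormal_basis B" and x: "norm x = 1" "x \<notin> axes B" and a: "1 < a"
  shows "(\<Sum>v\<in>B. clam x v powr a) < real CARD('n) - 1"
proof -
  have o: "orthonormal B" "card B = CARD('n)" "finite B"
    using B orthonormal_basis_iff orthonormal_finite by auto
  have unit: "norm w = 1" if "w \<in> B" for w using o(1) that by (simp add: orthonormal_def)
  have le: "clam x v powr a \<le> clam x v" for v
    using clam_bounds[of x v] a powr_mono'[of 1 a "clam x v"] by (cases "clam x v = 0") auto
  obtain v where v: "v \<in> B" "x \<bullet> v \<noteq> 0"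
  proof (rule ccontr)
    assume "\<not> thesis"
    then have "(\<Sum>v\<in>B. (x \<bullet> v)\<^sup>2) = 0" using that by (intro sum.neutral) auto
    then show False using orthonormal_basis_Parseval[OF B, of x] x by simp
  qed
  have "\<bar>x \<bullet> v\<bar> < 1"
  proof (rule ccontr)
    assume "\<not> \<bar>x \<bullet> v\<bar> < 1"
    then have *: "\<bar>x \<bullet> v\<bar> = 1" using abs_inner_unit_le[OF x(1) unit[OF v(1)]] by simp
    have "(x - v) \<bullet> (x - v) = 0 \<or> (x + v) \<bullet> (x + v) = 0"
      using * x(1) unit[OF v(1)]
      by (auto simp: inner_diff inner_add inner_commute norm_eq_1 abs_if split: if_splits)
    then have "x = v \<or> x = - v" by (auto simp: eq_neg_iff_add_eq_0)
    then show False using v x by (auto simp: axes_def)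
  qed
  then have "0 < clam x v" "clam x v < 1"
    using clam_bounds[of x v] clam_eq_0_iff[of x v] clam_eq_1_iff[of x v] v(2) by linarith+
  then have "clam x v powr a < clam x v powr 1" using a by (intro powr_less_mono') auto
  then have "(\<Sum>v\<in>B. clam x v powr a) < (\<Sum>v\<in>B. clam x v)"
    using le v \<open>0 < clam x v\<close> by (intro sum_strict_mono_ex1 o) auto
  also have "\<dots> \<le> real CARD('n) - 1" by (rule sum_clam_basis_le[OF B x(1)])
  finally show ?thesis .
qed

text \<open>The left-hand side is the potential of the measures with equal masses on the axes of B.
  It is continuous and strictly below the bound on the compact complement of the open cells, so its
  maximum there leaves a gap.\<close>

lemma potential_gap:
  fixes B :: "(real ^ 'n::finite) set"
  assumes B: "orthonormal_basis B" and a: "1 < a" and \<epsilon>: "0 < \<epsilon>"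
  shows "\<exists>\<eta>>0. \<forall>x. norm x = 1 \<longrightarrow> x \<notin> (\<Union>v\<in>B. cell \<epsilon> v) \<longrightarrow>
    (\<Sum>v\<in>B. clam x v powr a) / real CARD('n) \<le> 1 - 1 / real CARD('n) - \<eta>"
proof -
  define F where "F x = (\<Sum>v\<in>B. clam x v powr a) / real CARD('n)" for x
  define K where "K = sphere 0 1 \<inter> (\<Inter>v\<in>B. {x. \<bar>x \<bullet> v\<bar> \<le> 1 - \<epsilon>\<^sup>2 / 2})"
  have K: "x \<in> K \<longleftrightarrow> norm x = 1 \<and> x \<notin> (\<Union>v\<in>B. cell \<epsilon> v)" for x
    by (auto simp: K_def cell_def)
  have less: "F x < 1 - 1 / real CARD('n)" if "x \<in> K" for x
  proof -
    have "x \<notin> axes B"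
    proof
      assume "x \<in> axes B"
      then obtain v where v: "v \<in> B" "x \<in> {v, - v}" by (auto simp: axes_def)
      then have "v \<bullet> v = 1" using B by (auto simp: orthonormal_basis_def norm_eq_1)
      then have "\<bar>x \<bullet> v\<bar> = 1" using v(2) by auto
      then show False using that v(1) \<epsilon> by (auto simp: K_def)
    qed
    then have "(\<Sum>v\<in>B. clam x v powr a) < real CARD('n) - 1"
      using sum_clam_powr_basis_less[OF B _ _ a] that by (simp add: K_def)
    then have "F x < (real CARD('n) - 1) / real CARD('n)"
      unfolding F_def by (intro divide_strict_right_mono) auto
    then show ?thesis by (simp add: diff_divide_distrib)
  qed
  have "compact K"
    unfolding K_def by (intro compact_Int_closed compact_sphere closed_INT ballI closed_Collect_le
        continuous_intros)
  show ?thesis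
  proof (cases "K = {}")
    case True
    then show ?thesis using K by (intro exI[of _ 1]) auto
  next
    case False
    have "continuous_on K F"
      unfolding F_def
      by (intro continuous_intros continuous_on_powr' continuous_on_clam) (use a clam_bounds in auto)
    then obtain x0 where x0: "x0 \<in> K" "\<And>x. x \<in> K \<Longrightarrow> F x \<le> F x0"
      using continuous_attains_sup[OF \<open>compact K\<close> False] by blast
    then show ?thesis
      using less[OF x0(1)] K unfolding F_def[symmetric]
      by (intro exI[of _ "1 - 1 / real CARD('n) - F x0"]) auto
  qed
qed

lemma borel_cell [measurable]: "cell \<epsilon> v \<in> sets borel"
proof -
  have "cell \<epsilon> v = sphere 0 1 \<inter> {x. 1 - \<epsilon>\<^sup>2 / 2 < \<bar>x \<bullet> v\<bar>}" by (auto simp: cell_def)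
  moreover have "open {x. 1 - \<epsilon>\<^sup>2 / 2 < \<bar>x \<bullet> v\<bar>}" by (intro open_Collect_less continuous_intros)
  ultimately show ?thesis by simp
qed

text \<open>A common point would have two inner products of modulus above 7/8, where 7/8 is the
  value of \<open>1 - \<epsilon>\<^sup>2 / 2\<close> at \<epsilon> = 1/2; their squares already
  exceed the total 1 allowed by Parseval.\<close>

lemma cells_disjoint:
  fixes B :: "(real ^ 'n::finite) set"
  assumes B: "orthonormal_basis B" and vw: "v \<in> B" "w \<in> B" "v \<noteq> w" and \<epsilon>: "0 \<le> \<epsilon>" "\<epsilon> \<le> 1 / 2"
  shows "cell \<epsilon> v \<inter> cell \<epsilon> w = {}"
proof (rule ccontr)
  assume "cell \<epsilon> v \<inter> cell \<epsilon> w \<noteq> {}"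
  then obtain x where x: "norm x = 1" "1 - \<epsilon>\<^sup>2 / 2 < \<bar>x \<bullet> v\<bar>" "1 - \<epsilon>\<^sup>2 / 2 < \<bar>x \<bullet> w\<bar>"
    by (auto simp: cell_def)
  have "\<epsilon>\<^sup>2 \<le> (1 / 2)\<^sup>2" using \<epsilon> by (intro power_mono)
  then have "7 / 8 < \<bar>x \<bullet> v\<bar>" "7 / 8 < \<bar>x \<bullet> w\<bar>" using x by (simp_all add: power2_eq_square)
  then have "(7 / 8)\<^sup>2 < \<bar>x \<bullet> v\<bar>\<^sup>2" "(7 / 8)\<^sup>2 < \<bar>x \<bullet> w\<bar>\<^sup>2" by (intro power_strict_mono; simp)+
  then have "1 < (x \<bullet> v)\<^sup>2 + (x \<bullet> w)\<^sup>2" by (simp add: power2_eq_square)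
  also have "\<dots> = (\<Sum>u\<in>{v, w}. (x \<bullet> u)\<^sup>2)" using vw by simp
  also have "\<dots> \<le> (\<Sum>u\<in>B. (x \<bullet> u)\<^sup>2)"
    using vw B orthonormal_finite(1) by (intro sum_mono2) (auto simp: orthonormal_basis_iff)
  also have "\<dots> = 1" using orthonormal_basis_Parseval[OF B] x(1) by simp
  finally show False by simp
qed

section \<open>Energy of measures concentrated near orthogonal axes\<close>

context sphere_prob
begin

lemma cell_events [simp]: "cell \<epsilon> v \<in> events"
proof -
  have "cell \<epsilon> v \<inter> sphere 0 1 = cell \<epsilon> v" by (auto simp: cell_def)
  then show ?thesis using sets_mu_borel[OF borel_cell[of \<epsilon> v]] by simp
qed

text \<open>Turns an averaged loss into an actual point of a cell, to which the pointwise geometric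
  estimate can be applied.\<close>

lemma exists_below_average:
  fixes h :: "real ^ 'n \<Rightarrow> real"
  assumes A: "A \<in> events" "0 < prob A" and h: "integrable \<mu> h"
  shows "\<exists>y\<in>A. h y * prob A \<le> (LINT y|\<mu>. indicator A y * h y)"
proof (rule ccontr)
  define I where "I = (LINT y|\<mu>. indicator A y * h y)"
  assume "\<not> ?thesis"
  then have gt: "I / prob A < h y" if "y \<in> A" for y
    using that A(2) by (auto simp: I_def field_simps)
  have i1: "integrable \<mu> (\<lambda>y. indicator A y * h y)"
    using integrable_mult_indicator[OF A(1) h] by simp
  have i2: "integrable \<mu> (\<lambda>y. indicator A y * (I / prob A))"
    using A by (intro integrable_mult_left) (simp add: integrable_real_indicator emeasure_eq_measure)
  have eq: "indicator A y * (h y - I / prob A) = indicator A y * h y - indicator A y * (I / prob A)" for y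
    by (simp add: algebra_simps)
  have "(LINT y|\<mu>. indicator A y * (h y - I / prob A)) = I - prob A * (I / prob A)"
    unfolding eq by (subst Bochner_Integration.integral_diff[OF i1 i2]) (use A in \<open>simp add: I_def\<close>)
  then have z: "(LINT y|\<mu>. indicator A y * (h y - I / prob A)) = 0" using A by simp
  have i3: "integrable \<mu> (\<lambda>y. indicator A y * (h y - I / prob A))"
    unfolding eq by (intro Bochner_Integration.integrable_diff i1 i2)
  have "AE y in \<mu>. 0 \<le> indicator A y * (h y - I / prob A)"
    using gt by (intro AE_I2) (auto simp: indicator_def less_imp_le)
  then have "AE y in \<mu>. indicator A y * (h y - I / prob A) = 0"
    using integral_nonneg_eq_0_iff_AE[OF i3] z by simp
  then have "AE y in \<mu>. y \<notin> A"
    by eventually_elim (use gt in \<open>force simp: indicator_def\<close>)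
  then have "prob A = 0" using A(1) by (subst prob_eq_0) auto
  then show False using A by simp
qed

text \<open>Averaging \<open>clam_same_cell\<close> over the other cells: spreading mass inside a cell costs a distance,
  to first order, in the interaction with the other cells, and gains only its power \<open>a > 1\<close>.\<close>

lemma same_cell_energy_le:
  fixes a :: real
  assumes B: "orthonormal_basis B" and v: "v \<in> B" and a: "1 < a"
    and \<epsilon>: "0 < \<epsilon>" "real CARD('n) * \<epsilon> \<le> 1 / 2" "4 * pi * real CARD('n) * (2 * \<epsilon>) powr (a - 1) \<le> 1"
    and mass: "\<And>w. w \<in> B \<Longrightarrow> 1 / (2 * real CARD('n)) \<le> prob (cell \<epsilon> w)"
  shows "(LINT x|\<mu>. LINT y|\<mu>. indicator (cell \<epsilon> v) x * indicator (cell \<epsilon> v) y * kpow (ereal a) x y)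
    \<le> (\<Sum>w\<in>B - {v}. LINT x|\<mu>. LINT y|\<mu>.
          indicator (cell \<epsilon> v) x * indicator (cell \<epsilon> w) y * (1 - kpow (ereal a) x y))"
proof -
  define N where "N = real CARD('n)"
  have N: "N > 0" by (simp add: N_def)
  define f where "f = (kpow (ereal a) :: real ^ 'n \<Rightarrow> _)"
  have f: "f x y = clam x y powr a" for x y :: "real ^ 'n" by (simp add: f_def kpow_def)
  have f01: "0 \<le> f x y" "f x y \<le> 1" for x y :: "real ^ 'n"
    using a kpow_nonneg kpow_le_1[of "ereal a"] by (auto simp: f_def)
  have f_le: "f x y \<le> clam x y" for x y :: "real ^ 'n"
    using clam_bounds[of x y] a powr_mono'[of 1 a "clam x y"] by (cases "clam x y = 0") (auto simp: f)
  have fm [measurable]: "case_prod f \<in> borel_measurable (borel \<Otimes>\<^sub>M borel)"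
    unfolding f_def split_beta' by measurable
  define g where "g w x = (LINT y|\<mu>. indicator (cell \<epsilon> w) y * (1 - f x y))" for w x
  have bk: "bounded_kernel (\<lambda>x y. indicator (cell \<epsilon> w) y * (1 - f x y))" for w
    unfolding bounded_kernel_def
  proof (intro conjI exI[of _ 1] allI)
    show "(\<lambda>(x, y). indicator (cell \<epsilon> w) y * (1 - f x y)) \<in> borel_measurable (borel \<Otimes>\<^sub>M borel)"
      by measurable
  qed (use f01 in \<open>auto simp: indicator_def\<close>)
  have g_int: "integrable \<mu> (g w)" for w
    using kernel_integrable_iterated[OF bk[of w]] by (simp add: g_def[abs_def])
  have g_nn: "0 \<le> g w x" for w x
    unfolding g_def using f01 by (intro Bochner_Integration.integral_nonneg) (auto simp: indicator_def)
  have clam_int: "integrable \<mu> (\<lambda>y. 1 - clam x y)" for x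
  proof (rule integrable_const_bound[of _ 1])
    have "\<bar>1 - clam x y\<bar> \<le> 1" for y using clam_bounds[of x y] by simp
    then show "AE y in \<mu>. norm (1 - clam x y) \<le> 1" by simp
  qed (rule borel_measurable_mu, measurable)
  \<comment> \<open>One y has to serve x and x' simultaneously, so the sum of both losses is
    averaged. The factor \<open>2 * N\<close> is the reciprocal of the least mass of a cell.\<close>
  have avg: "\<exists>y\<in>cell \<epsilon> w. ((1 - clam x y) + (1 - clam x' y)) \<le> 2 * N * (g w x + g w x')"
    if w: "w \<in> B" for w x x'
  proof -
    define h where "h y = (1 - clam x y) + (1 - clam x' y)" for y
    have m: "1 / (2 * N) \<le> prob (cell \<epsilon> w)" using mass[OF w] by (simp add: N_def)
    then have pos: "0 < prob (cell \<epsilon> w)" using N by (smt (verit) divide_pos_pos)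
    have hint: "integrable \<mu> h"
      unfolding h_def by (intro Bochner_Integration.integrable_add clam_int)
    obtain y where y: "y \<in> cell \<epsilon> w" "h y * prob (cell \<epsilon> w) \<le> (LINT y|\<mu>. indicator (cell \<epsilon> w) y * h y)"
      using exists_below_average[OF cell_events pos hint] by blast
    have "(LINT y|\<mu>. indicator (cell \<epsilon> w) y * h y) \<le>
        (LINT y|\<mu>. indicator (cell \<epsilon> w) y * (1 - f x y) + indicator (cell \<epsilon> w) y * (1 - f x' y))"
    proof (rule integral_mono)
      show "integrable \<mu> (\<lambda>y. indicator (cell \<epsilon> w) y * h y)"
        using integrable_mult_indicator[OF cell_events hint] by simp
      show "integrable \<mu> (\<lambda>y. indicator (cell \<epsilon> w) y * (1 - f x y) + indicator (cell \<epsilon> w) y * (1 - f x' y))"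
        by (intro Bochner_Integration.integrable_add kernel_integrable[OF bk])
      show "indicator (cell \<epsilon> w) y * h y \<le> indicator (cell \<epsilon> w) y * (1 - f x y) + indicator (cell \<epsilon> w) y * (1 - f x' y)" for y
        using f_le[of x y] f_le[of x' y] by (auto simp: h_def indicator_def)
    qed
    also have "\<dots> = g w x + g w x'"
      unfolding g_def by (intro Bochner_Integration.integral_add kernel_integrable[OF bk])
    finally have "h y * prob (cell \<epsilon> w) \<le> g w x + g w x'" using y(2) by simp
    moreover have "h y * (1 / (2 * N)) \<le> h y * prob (cell \<epsilon> w)"
      using m clam_bounds(2)[of x y] clam_bounds(2)[of x' y] by (intro mult_left_mono) (auto simp: h_def)
    ultimately have "h y * (1 / (2 * N)) \<le> g w x + g w x'" by simp
    then have "h y \<le> 2 * N * (g w x + g w x')" using N by (simp add: field_simps)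
    then show ?thesis using y(1) by (auto simp: h_def)
  qed
  define G where "G x = (\<Sum>w\<in>B - {v}. g w x)" for x
  have G_int: "integrable \<mu> G" unfolding G_def by (intro Bochner_Integration.integrable_sum g_int)
  have G_nn: "0 \<le> G x" for x unfolding G_def by (intro sum_nonneg g_nn)
  have pt: "f x x' \<le> 1 / 2 * (G x + G x')" if x: "x \<in> cell \<epsilon> v" "x' \<in> cell \<epsilon> v" for x x'
  proof -
    obtain y where y: "\<And>w. w \<in> B \<Longrightarrow> y w \<in> cell \<epsilon> w"
      "\<And>w. w \<in> B \<Longrightarrow> ((1 - clam x (y w)) + (1 - clam x' (y w))) \<le> 2 * N * (g w x + g w x')"
      using avg[of _ x x'] by metis
    have c: "clam x x' \<le> 2 * \<epsilon>"
      "clam x x' \<le> pi * (\<Sum>w\<in>B - {v}. (1 - clam x (y w)) + (1 - clam x' (y w)))"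
      using clam_same_cell[OF B v x, of y] y(1) \<epsilon> by auto
    note c(2)
    also have "pi * (\<Sum>w\<in>B - {v}. (1 - clam x (y w)) + (1 - clam x' (y w)))
        \<le> pi * (\<Sum>w\<in>B - {v}. 2 * N * (g w x + g w x'))"
      using y(2) by (intro mult_left_mono sum_mono) auto
    also have "\<dots> = 2 * pi * N * (G x + G x')"
      by (simp add: G_def sum.distrib sum_distrib_left algebra_simps)
    finally have c2: "clam x x' \<le> 2 * pi * N * (G x + G x')" .
    \<comment> \<open>One factor is bounded by the first-order loss, the remaining power by the
      diameter \<open>2 * \<epsilon>\<close> of the cell. Their product is where the constant
      \<open>4 * pi * N\<close> of the smallness condition arises.\<close>
    have "f x x' = clam x x' * clam x x' powr (a - 1)"
      using clam_bounds(1)[of x x'] powr_mult_base[of "clam x x'" "a - 1"] by (simp add: f)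
    also have "\<dots> \<le> (2 * pi * N * (G x + G x')) * (2 * \<epsilon>) powr (a - 1)"
      using c(1) c2 a clam_bounds(1)[of x x'] G_nn N
      by (intro mult_mono powr_mono2) auto
    also have "\<dots> = 1 / 2 * (G x + G x') * (4 * pi * N * (2 * \<epsilon>) powr (a - 1))" by simp
    also have "\<dots> \<le> 1 / 2 * (G x + G x') * 1"
      using \<epsilon>(3) G_nn[of x] G_nn[of x'] by (intro mult_left_mono) (auto simp: N_def)
    finally show ?thesis by simp
  qed
  define C where "C x = (indicator (cell \<epsilon> v) x :: real)" for x
  have C01: "0 \<le> C x" "C x \<le> 1" for x by (auto simp: C_def indicator_def)
  have Cint: "integrable \<mu> C"
    unfolding C_def by (simp add: integrable_real_indicator emeasure_eq_measure)
  have CGint: "integrable \<mu> (\<lambda>x. C x * G x)"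
    using integrable_mult_indicator[OF cell_events G_int] by (simp add: C_def)
  define I where "I = (LINT x|\<mu>. C x * G x)"
  have I_nn: "0 \<le> I" unfolding I_def using C01 G_nn by (intro Bochner_Integration.integral_nonneg) auto
  have bkC: "bounded_kernel (\<lambda>x y. C x * C y * f x y)"
    unfolding bounded_kernel_def
  proof (intro conjI exI[of _ 1] allI)
    show "(\<lambda>(x, y). C x * C y * f x y) \<in> borel_measurable (borel \<Otimes>\<^sub>M borel)"
      unfolding C_def by measurable
  qed (use f01 in \<open>auto simp: C_def indicator_def\<close>)
  have inner: "(LINT y|\<mu>. C x * C y * f x y) \<le> 1 / 2 * (C x * G x + C x * I)" for x
  proof -
    have "(LINT y|\<mu>. C x * C y * f x y) \<le> (LINT y|\<mu>. C x * (1 / 2) * (C y * G x + C y * G y))"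
    proof (rule integral_mono[OF kernel_integrable[OF bkC]])
      show "integrable \<mu> (\<lambda>y. C x * (1 / 2) * (C y * G x + C y * G y))"
        by (intro integrable_mult_right Bochner_Integration.integrable_add integrable_mult_left Cint CGint)
      show "C x * C y * f x y \<le> C x * (1 / 2) * (C y * G x + C y * G y)" for y
        using pt[of x y] by (auto simp: C_def indicator_def)
    qed
    also have "\<dots> = C x * (1 / 2) * ((LINT y|\<mu>. C y) * G x + I)"
      unfolding I_def
      by (subst integral_mult_right_zero, subst Bochner_Integration.integral_add)
        (auto intro!: integrable_mult_left Cint CGint)
    also have "\<dots> \<le> C x * (1 / 2) * (1 * G x + I)"
    proof -
      have "(LINT y|\<mu>. C y) \<le> (LINT y|\<mu>. 1)" using C01 Cint by (intro integral_mono) auto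
      then show ?thesis using C01 G_nn by (intro mult_left_mono add_right_mono mult_right_mono) (auto simp: prob_space)
    qed
    finally show ?thesis by (simp add: algebra_simps)
  qed
  have "(LINT x|\<mu>. LINT y|\<mu>. C x * C y * f x y) \<le> (LINT x|\<mu>. 1 / 2 * (C x * G x + C x * I))"
    by (intro integral_mono inner kernel_integrable_iterated bkC integrable_mult_right
        Bochner_Integration.integrable_add integrable_mult_left Cint CGint)
  also have "\<dots> = 1 / 2 * (I + (LINT x|\<mu>. C x) * I)"
    unfolding I_def by (subst integral_mult_right_zero, subst Bochner_Integration.integral_add)
        (auto intro!: integrable_mult_left Cint CGint)
  \<comment> \<open>The mass of the cell is at most 1, so the two halves, one from each variable,
    add up to no more than I.\<close>
  also have "\<dots> \<le> 1 / 2 * (I + 1 * I)"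
  proof -
    have "(LINT y|\<mu>. C y) \<le> (LINT y|\<mu>. 1)" using C01 Cint by (intro integral_mono) auto
    then show ?thesis using I_nn by (intro mult_left_mono add_left_mono mult_right_mono) (auto simp: prob_space)
  qed
  also have "\<dots> = I" by simp
  also have "I = (\<Sum>w\<in>B - {v}. LINT x|\<mu>. C x * g w x)"
    unfolding I_def G_def sum_distrib_left
    by (rule Bochner_Integration.integral_sum)
      (use integrable_mult_indicator[OF cell_events g_int] in \<open>simp add: C_def\<close>)
  also have "\<dots> = (\<Sum>w\<in>B - {v}. LINT x|\<mu>. LINT y|\<mu>. C x * indicator (cell \<epsilon> w) y * (1 - f x y))"
    unfolding g_def by (simp add: mult.assoc)
  finally show ?thesis by (simp add: C_def f_def)
qed

text \<open>With p the mass outside the cells, pairs of cells contribute at most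
  \<open>(1 - 1 / N) * (1 - p)\<^sup>2\<close>, as if the cells were points on the axes, and pairs
  meeting the rest at most \<open>2 * p * (1 - 1 / N - \<eta>)\<close>. The sum exceeds
  \<open>1 - 1 / N\<close> by \<open>p * ((1 - 1 / N) * p - 2 * \<eta>)\<close>, hence the condition
  that p be at most \<open>2 * \<eta>\<close>.\<close>

lemma energy_le_near_axes:
  fixes a :: real
  assumes B: "orthonormal_basis B" and a: "1 < a"
    and \<epsilon>: "0 < \<epsilon>" "real CARD('n) * \<epsilon> \<le> 1 / 2" "4 * pi * real CARD('n) * (2 * \<epsilon>) powr (a - 1) \<le> 1"
    and mass: "\<And>w. w \<in> B \<Longrightarrow> 1 / (2 * real CARD('n)) \<le> prob (cell \<epsilon> w)"
    and small: "prob (sphere 0 1 - (\<Union>v\<in>B. cell \<epsilon> v)) \<le> 2 * \<eta>"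
    and gap: "\<And>x. norm x = 1 \<Longrightarrow> x \<notin> (\<Union>v\<in>B. cell \<epsilon> v) \<Longrightarrow>
      (LINT y|\<mu>. kpow (ereal a) x y) \<le> 1 - 1 / real CARD('n) - \<eta>"
  shows "energy (ereal a) \<mu> \<le> 1 / 2 * (1 - 1 / real CARD('n))"
proof -
  define N where "N = real CARD('n)"
  have N: "N \<ge> 1" by (simp add: N_def Suc_leI)
  have o: "orthonormal B" "card B = CARD('n)" "finite B"
    using B orthonormal_basis_iff orthonormal_finite by auto
  have "1 * \<epsilon> \<le> N * \<epsilon>" using N \<epsilon>(1) by (intro mult_right_mono) auto
  then have \<epsilon>_half: "\<epsilon> \<le> 1 / 2" using \<epsilon>(2) by (simp add: N_def)
  define f where "f = (kpow (ereal a) :: real ^ 'n \<Rightarrow> _)" 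
  have f01: "0 \<le> f x y" "f x y \<le> 1" for x y :: "real ^ 'n"
    using a kpow_nonneg kpow_le_1[of "ereal a"] by (auto simp: f_def)
  have fm [measurable]: "case_prod f \<in> borel_measurable (borel \<Otimes>\<^sub>M borel)"
    unfolding f_def split_beta' by measurable
  define C where "C v x = (indicator (cell \<epsilon> v) x :: real)" for v x :: "real ^ 'n"
  have Cm [measurable]: "C v \<in> borel_measurable borel" for v unfolding C_def by simp
  define A where "A = sphere 0 1 - (\<Union>v\<in>B. cell \<epsilon> v)"
  have Aev: "A \<in> events"
    unfolding A_def using o(3) space_mu[symmetric] by (auto intro!: sets.finite_UN)
  have Ab: "A \<in> sets borel" unfolding A_def using o(3) by (auto intro!: sets.finite_UN)
  define R where "R x = (indicator A x :: real)" for x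
  have Rm [measurable]: "R \<in> borel_measurable borel" unfolding R_def using Ab by simp
  define m where "m = (\<lambda>v. prob (cell \<epsilon> v))"
  have disj: "disjoint_family_on (cell \<epsilon>) B"
    using cells_disjoint[OF B] \<epsilon>(1) \<epsilon>_half unfolding disjoint_family_on_def by auto
  have partition: "(\<Sum>v\<in>B. C v x) + R x = 1" if "norm x = 1" for x
  proof -
    have "(\<Sum>v\<in>B. C v x) = indicator (\<Union>v\<in>B. cell \<epsilon> v) x"
      unfolding C_def by (rule indicator_UN_disjoint[OF o(3) disj, symmetric])
    then show ?thesis using that by (auto simp: R_def A_def indicator_def)
  qed
  have sum_m: "(\<Sum>v\<in>B. m v) = 1 - prob A"
  proof -
    have "(\<Sum>v\<in>B. m v) = prob (\<Union>v\<in>B. cell \<epsilon> v)"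
      unfolding m_def by (rule finite_measure_finite_Union[symmetric]) (use o disj in auto)
    also have "\<dots> = 1 - prob (space \<mu> - (\<Union>v\<in>B. cell \<epsilon> v))"
      by (subst prob_compl) (use o in \<open>auto intro!: sets.finite_UN\<close>)
    finally show ?thesis by (simp add: A_def space_mu)
  qed
  have C01: "0 \<le> C v x" "C v x \<le> 1" and R01: "0 \<le> R x" "R x \<le> 1" for v x
    by (auto simp: C_def R_def indicator_def)
  have bkf: "bounded_kernel f"
    unfolding f_def using a by (intro bounded_kernel_kpow) simp
  have prod01: "\<bar>r * s * t\<bar> \<le> 1" if "0 \<le> r" "r \<le> 1" "0 \<le> s" "s \<le> 1" "0 \<le> t" "t \<le> 1" for r s t :: real
    using that by (simp add: abs_mult mult_le_one)
  have bkC: "bounded_kernel (\<lambda>x y. C v x * C w y * f x y)" for v w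
    unfolding bounded_kernel_def
    by (intro conjI exI[of _ 1] allI prod01 C01 f01) measurable
  have bkC': "bounded_kernel (\<lambda>x y. C v x * C w y * (1 - f x y))" for v w
    unfolding bounded_kernel_def
  proof (intro conjI exI[of _ 1] allI prod01 C01)
    show "(\<lambda>(x, y). C v x * C w y * (1 - f x y)) \<in> borel_measurable (borel \<Otimes>\<^sub>M borel)" by measurable
  qed (use f01 in auto)
  have bkR: "bounded_kernel (\<lambda>x y. R x * f x y)" "bounded_kernel (\<lambda>x y. R y * f x y)"
    unfolding bounded_kernel_def using prod01[of 1] R01 f01
    by (auto intro!: exI[of _ 1])
  define J where "J v w = (LINT x|\<mu>. LINT y|\<mu>. C v x * C w y * f x y)" for v w
  define L where "L v w = (LINT x|\<mu>. LINT y|\<mu>. C v x * C w y * (1 - f x y))" for v w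
  have JL: "J v w + L v w = m v * m w" for v w
  proof -
    have "J v w + L v w = (LINT x|\<mu>. (LINT y|\<mu>. C v x * C w y * f x y) + (LINT y|\<mu>. C v x * C w y * (1 - f x y)))"
      unfolding J_def L_def
      by (rule Bochner_Integration.integral_add[symmetric]) (intro kernel_integrable_iterated bkC bkC')+
    also have "\<dots> = (LINT x|\<mu>. LINT y|\<mu>. C v x * C w y)"
    proof (rule Bochner_Integration.integral_cong[OF refl])
      fix x
      show "(LINT y|\<mu>. C v x * C w y * f x y) + (LINT y|\<mu>. C v x * C w y * (1 - f x y)) = (LINT y|\<mu>. C v x * C w y)"
      proof -
        have "C v x * C w y * f x y + C v x * C w y * (1 - f x y) = C v x * C w y" for y
          by (simp add: algebra_simps)
        then show ?thesis
          using Bochner_Integration.integral_add[OF kernel_integrable[OF bkC[of v w], of x]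
              kernel_integrable[OF bkC'[of v w], of x]] by simp
      qed
    qed
    also have "\<dots> = m v * m w"
      by (simp add: C_def m_def)
    finally show ?thesis .
  qed
  have diag: "J v v \<le> (\<Sum>w\<in>B - {v}. L v w)" if "v \<in> B" for v
    using same_cell_energy_le[OF B that a \<epsilon> mass] unfolding J_def L_def C_def f_def .
  \<comment> \<open>The energy inside a cell is paid by the deficits of that cell towards the
    others, which fill the off-diagonal terms up to products of masses.\<close>
  have rows: "(\<Sum>w\<in>B. J v w) \<le> m v * (\<Sum>w\<in>B. m w) - (m v)\<^sup>2" if v: "v \<in> B" for v
  proof -
    have "(\<Sum>w\<in>B. J v w) = J v v + (\<Sum>w\<in>B - {v}. J v w)" using o(3) v by (rule sum.remove)
    also have "\<dots> \<le> (\<Sum>w\<in>B - {v}. L v w) + (\<Sum>w\<in>B - {v}. J v w)" using diag[OF v] by simp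
    also have "\<dots> = (\<Sum>w\<in>B - {v}. m v * m w)" by (simp add: sum.distrib[symmetric] JL[symmetric] add.commute)
    also have "\<dots> = m v * (\<Sum>w\<in>B. m w) - (m v)\<^sup>2"
      using o(3) v by (simp add: sum_diff1 sum_distrib_left power2_eq_square)
    finally show ?thesis .
  qed
  define M where "M = (\<Sum>v\<in>B. m v)"
  \<comment> \<open>Cauchy-Schwarz in variance form: for given total mass the sum of squares is
    least when the cells have equal mass.\<close>
  have "0 \<le> (\<Sum>v\<in>B. (m v - M / N)\<^sup>2)" by (intro sum_nonneg) simp
  also have "\<dots> = (\<Sum>v\<in>B. (m v)\<^sup>2 - 2 * M / N * m v + (M / N)\<^sup>2)"
    by (rule sum.cong) (auto simp: power2_diff)
  also have "\<dots> = (\<Sum>v\<in>B. (m v)\<^sup>2) - 2 * M / N * M + N * (M / N)\<^sup>2"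
    unfolding sum.distrib sum_subtractf sum_distrib_left[symmetric] M_def[symmetric] using o by (simp add: N_def)
  also have "\<dots> = (\<Sum>v\<in>B. (m v)\<^sup>2) - M\<^sup>2 / N" using N by (simp add: power2_eq_square field_simps)
  finally have CS: "M\<^sup>2 / N \<le> (\<Sum>v\<in>B. (m v)\<^sup>2)" by simp
  have "(\<Sum>v\<in>B. \<Sum>w\<in>B. J v w) \<le> (\<Sum>v\<in>B. m v * M - (m v)\<^sup>2)"
    unfolding M_def by (intro sum_mono rows)
  also have "\<dots> = M\<^sup>2 - (\<Sum>v\<in>B. (m v)\<^sup>2)"
    by (simp add: sum_subtractf sum_distrib_right[symmetric] M_def[symmetric] power2_eq_square)
  also have "\<dots> \<le> (1 - 1 / N) * M\<^sup>2" using CS by (simp add: algebra_simps)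
  finally have main: "(\<Sum>v\<in>B. \<Sum>w\<in>B. J v w) \<le> (1 - 1 / N) * M\<^sup>2" .
  define U where "U x = (LINT y|\<mu>. f x y)" for x
  have RU: "(LINT x|\<mu>. LINT y|\<mu>. R x * f x y) \<le> prob A * (1 - 1 / N - \<eta>)"
  proof -
    have "(LINT x|\<mu>. LINT y|\<mu>. R x * f x y) \<le> (LINT x|\<mu>. R x * (1 - 1 / N - \<eta>))"
    proof (rule integral_mono[OF kernel_integrable_iterated[OF bkR(1)]])
      show "integrable \<mu> (\<lambda>x. R x * (1 - 1 / N - \<eta>))"
        unfolding R_def using Aev by (intro integrable_mult_left) (simp add: integrable_real_indicator emeasure_eq_measure)
      show "(LINT y|\<mu>. R x * f x y) \<le> R x * (1 - 1 / N - \<eta>)" if "x \<in> space \<mu>" for x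
        using gap[of x] by (auto simp: R_def indicator_def A_def N_def f_def)
    qed
    then show ?thesis using Aev by (simp add: R_def)
  qed
  have RU': "(LINT x|\<mu>. LINT y|\<mu>. R y * f x y) = (LINT x|\<mu>. LINT y|\<mu>. R x * f x y)"
    by (subst kernel_swap[OF bkR(2)]) (simp add: f_def kpow_commute)
  \<comment> \<open>Both terms with \<open>R\<close> count the pairs that lie outside the cells in
    both variables, so the right-hand side is too large by \<open>R x * R y * f x y\<close>.\<close>
  have inner_sum: "(LINT y|\<mu>. f x y) \<le> (\<Sum>v\<in>B. \<Sum>w\<in>B. LINT y|\<mu>. C v x * C w y * f x y)
      + (LINT y|\<mu>. R x * f x y) + (LINT y|\<mu>. R y * f x y)" if x: "x \<in> space \<mu>" for x
  proof -
    have i: "integrable \<mu> (\<lambda>y. \<Sum>v\<in>B. \<Sum>w\<in>B. C v x * C w y * f x y)"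
      by (intro Bochner_Integration.integrable_sum kernel_integrable[OF bkC])
    have "(LINT y|\<mu>. f x y) \<le> (LINT y|\<mu>. (\<Sum>v\<in>B. \<Sum>w\<in>B. C v x * C w y * f x y) + R x * f x y + R y * f x y)"
    proof (rule integral_mono)
      show "integrable \<mu> (\<lambda>y. (\<Sum>v\<in>B. \<Sum>w\<in>B. C v x * C w y * f x y) + R x * f x y + R y * f x y)"
        by (intro Bochner_Integration.integrable_add i kernel_integrable[OF bkR(1)] kernel_integrable[OF bkR(2)])
      fix y assume y: "y \<in> space \<mu>"
      have "(\<Sum>v\<in>B. \<Sum>w\<in>B. C v x * C w y * f x y) = (\<Sum>v\<in>B. C v x) * (\<Sum>w\<in>B. C w y) * f x y"
        unfolding sum_product by (simp only: sum_distrib_right)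
      also have "\<dots> = (1 - R x) * (1 - R y) * f x y"
      proof -
        have "(\<Sum>v\<in>B. C v x) = 1 - R x" "(\<Sum>w\<in>B. C w y) = 1 - R y"
          using partition[of x] partition[of y] x y by (simp_all add: space_mu eq_diff_eq)
        then show ?thesis by simp
      qed
      finally have "(\<Sum>v\<in>B. \<Sum>w\<in>B. C v x * C w y * f x y) + R x * f x y + R y * f x y = f x y + R x * R y * f x y"
        by (simp add: algebra_simps)
      moreover have "0 \<le> R x * R y * f x y" using R01 f01 by simp
      ultimately show "f x y \<le> (\<Sum>v\<in>B. \<Sum>w\<in>B. C v x * C w y * f x y) + R x * f x y + R y * f x y" by simp
    qed (rule kernel_integrable[OF bkf])
    also have "\<dots> = (LINT y|\<mu>. (\<Sum>v\<in>B. \<Sum>w\<in>B. C v x * C w y * f x y)) + (LINT y|\<mu>. R x * f x y) + (LINT y|\<mu>. R y * f x y)"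
      by (subst Bochner_Integration.integral_add, intro Bochner_Integration.integrable_add i kernel_integrable[OF bkR(1)],
          rule kernel_integrable[OF bkR(2)], subst Bochner_Integration.integral_add, rule i,
          rule kernel_integrable[OF bkR(1)], rule refl)
    also have "(LINT y|\<mu>. (\<Sum>v\<in>B. \<Sum>w\<in>B. C v x * C w y * f x y)) =
        (\<Sum>v\<in>B. \<Sum>w\<in>B. LINT y|\<mu>. C v x * C w y * f x y)"
      by (subst Bochner_Integration.integral_sum, intro Bochner_Integration.integrable_sum kernel_integrable[OF bkC])
        (intro sum.cong refl Bochner_Integration.integral_sum kernel_integrable[OF bkC])
    finally show ?thesis .
  qed
  have iJ: "integrable \<mu> (\<lambda>x. \<Sum>v\<in>B. \<Sum>w\<in>B. LINT y|\<mu>. C v x * C w y * f x y)"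
    by (intro Bochner_Integration.integrable_sum kernel_integrable_iterated[OF bkC])
  have "(LINT x|\<mu>. LINT y|\<mu>. f x y) \<le> (LINT x|\<mu>. (\<Sum>v\<in>B. \<Sum>w\<in>B. LINT y|\<mu>. C v x * C w y * f x y)
      + (LINT y|\<mu>. R x * f x y) + (LINT y|\<mu>. R y * f x y))"
    by (intro integral_mono inner_sum Bochner_Integration.integrable_add iJ kernel_integrable_iterated[OF bkR(1)]
        kernel_integrable_iterated[OF bkR(2)] kernel_integrable_iterated[OF bkf])
  also have "\<dots> = (LINT x|\<mu>. (\<Sum>v\<in>B. \<Sum>w\<in>B. LINT y|\<mu>. C v x * C w y * f x y))
      + (LINT x|\<mu>. LINT y|\<mu>. R x * f x y) + (LINT x|\<mu>. LINT y|\<mu>. R y * f x y)"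
    by (subst Bochner_Integration.integral_add, intro Bochner_Integration.integrable_add iJ kernel_integrable_iterated[OF bkR(1)],
        rule kernel_integrable_iterated[OF bkR(2)], subst Bochner_Integration.integral_add, rule iJ,
        rule kernel_integrable_iterated[OF bkR(1)], rule refl)
  also have "(LINT x|\<mu>. (\<Sum>v\<in>B. \<Sum>w\<in>B. LINT y|\<mu>. C v x * C w y * f x y)) = (\<Sum>v\<in>B. \<Sum>w\<in>B. J v w)"
    unfolding J_def
    by (subst Bochner_Integration.integral_sum, intro Bochner_Integration.integrable_sum kernel_integrable_iterated[OF bkC])
      (intro sum.cong refl Bochner_Integration.integral_sum kernel_integrable_iterated[OF bkC])
  finally have "(LINT x|\<mu>. LINT y|\<mu>. f x y) \<le> (1 - 1 / N) * M\<^sup>2 + 2 * (prob A * (1 - 1 / N - \<eta>))"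
    using main RU RU' by simp
  also have "\<dots> = (1 - 1 / N) + prob A * ((1 - 1 / N) * prob A - 2 * \<eta>)"
    unfolding M_def sum_m by (simp add: power2_eq_square algebra_simps)
  also have "\<dots> \<le> 1 - 1 / N"
  proof -
    have "(1 - 1 / N) * prob A \<le> 1 * prob A" using N by (intro mult_right_mono) auto
    then have "(1 - 1 / N) * prob A - 2 * \<eta> \<le> 0" using small by (simp add: A_def)
    then have "prob A * ((1 - 1 / N) * prob A - 2 * \<eta>) \<le> 0" by (intro mult_nonneg_nonpos) auto
    then show ?thesis by simp
  qed
  finally show ?thesis by (simp add: energy_eq f_def N_def)
qed

end

section \<open>Sequences converging to a measure in \<open>P_Delta_eq\<close>\<close>

lemma sum_indicator_axes:
  fixes h :: "real ^ 'n::finite \<Rightarrow> real"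
  assumes B: "orthonormal B" and y: "y \<in> axes B" and even: "\<And>v. h (- v) = h v"
  shows "(\<Sum>v\<in>B. indicator {v, - v} y * h v) = h y"
proof -
  obtain u where u: "u \<in> B" "y \<in> {u, - u}" using y by (auto simp: axes_def)
  have "(\<Sum>v\<in>B. indicator {v, - v} y * h v) = (\<Sum>v\<in>B. if v = u then h u else 0)"
  proof (rule sum.cong[OF refl])
    fix v assume v: "v \<in> B"
    show "indicator {v, - v} y * h v = (if v = u then h u else 0)"
    proof (cases "v = u")
      case False
      then have "y \<notin> {v, - v}" using orthonormal_antipodal[OF B v u(1) _ u(2)] by blast
      then show ?thesis using False by simp
    qed (use u(2) in simp)
  qed
  also have "\<dots> = h u" using u(1) orthonormal_finite(1)[OF B] by simp
  also have "\<dots> = h y" using u(2) even by auto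
  finally show ?thesis .
qed

lemma exists_small_radius:
  assumes "1 < (a::real)" "1 \<le> N"
  shows "\<exists>\<epsilon>>0. N * \<epsilon> \<le> 1 / 2 \<and> 4 * pi * N * (2 * \<epsilon>) powr (a - 1) \<le> 1"
proof -
  \<comment> \<open>The solution of \<open>4 * pi * N * t powr (a - 1) = 1\<close>.\<close>
  define t where "t = (1 / (4 * pi * N)) powr (1 / (a - 1))"
  define \<epsilon> where "\<epsilon> = min (1 / (2 * N)) (t / 2)"
  have t: "0 < t" using assms by (simp add: t_def)
  have \<epsilon>: "0 < \<epsilon>" using assms t by (simp add: \<epsilon>_def)
  have "(2 * \<epsilon>) powr (a - 1) \<le> t powr (a - 1)"
    using assms \<epsilon> by (intro powr_mono2) (auto simp: \<epsilon>_def)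
  also have "\<dots> = 1 / (4 * pi * N)" using assms by (simp add: t_def powr_powr)
  finally have "4 * pi * N * (2 * \<epsilon>) powr (a - 1) \<le> 4 * pi * N * (1 / (4 * pi * N))"
    using assms by (intro mult_left_mono) auto
  also have "\<dots> = 1" using assms by simp
  finally have "4 * pi * N * (2 * \<epsilon>) powr (a - 1) \<le> 1" .
  moreover have "N * \<epsilon> \<le> N * (1 / (2 * N))" using assms by (intro mult_left_mono) (auto simp: \<epsilon>_def)
  ultimately show ?thesis using \<epsilon> assms by (intro exI[of _ \<epsilon>]) simp
qed

text \<open>Radius, gap and index are chosen for the exponent b alone. They serve every larger
  exponent because both the kernel and the power of \<open>2 * \<epsilon>\<close> decrease in it;
  this uniformity allows the exponent to vary with k.\<close>

lemma eventually_energy_le_near_P_Delta_eq: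
  fixes X :: "nat \<Rightarrow> 'a \<Rightarrow> real ^ 'n::finite"
  assumes \<Omega>: "prob_space \<Omega>" and X: "\<And>k. X k \<in> \<Omega> \<rightarrow>\<^sub>M sphere_borel" and Y: "Y \<in> \<Omega> \<rightarrow>\<^sub>M sphere_borel"
    and lim: "AE \<omega> in \<Omega>. (\<lambda>k. X k \<omega>) \<longlonglongrightarrow> Y \<omega>"
    and YP: "distr \<Omega> sphere_borel Y \<in> P_Delta_eq" and b: "1 < b"
  shows "\<forall>\<^sub>F k in sequentially. \<forall>a\<ge>b.
    energy (ereal a) (distr \<Omega> sphere_borel (X k)) \<le> 1 / 2 * (1 - 1 / real CARD('n))"
proof -
  interpret prob_space \<Omega> by fact
  define N where "N = real CARD('n)"
  have N: "1 \<le> N" by (simp add: N_def Suc_leI)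
  interpret YD: sphere_prob "distr \<Omega> sphere_borel Y"
    by (intro sphere_probI distr_sphere_probs \<Omega> Y)
  obtain B where B: "orthonormal_basis B" and AEB: "AE x in distr \<Omega> sphere_borel Y. x \<in> axes B"
    and PB: "\<And>v. v \<in> B \<Longrightarrow> YD.prob {v, - v} = 1 / N"
    using YD.P_Delta_eqD[OF YP] by (auto simp: N_def)
  have o: "orthonormal B" "card B = CARD('n)" "finite B"
    using B orthonormal_basis_iff orthonormal_finite by auto
  have unit: "norm v = 1" if "v \<in> B" for v using o(1) that by (simp add: orthonormal_def)
  have Yaxes: "AE \<omega> in \<Omega>. Y \<omega> \<in> axes B" using AE_distrD[OF Y AEB] .
  have m: "Z \<in> borel_measurable \<Omega>" if "Z \<in> \<Omega> \<rightarrow>\<^sub>M sphere_borel" for Z :: "'a \<Rightarrow> real ^ 'n"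
    using measurable_compose[OF that sphere_borel_measurable[of "\<lambda>x. x" borel]] by simp
  note [measurable] = m[OF X] m[OF Y]
  have sph: "norm (Z \<omega>) = 1" if "Z \<in> \<Omega> \<rightarrow>\<^sub>M sphere_borel" "\<omega> \<in> space \<Omega>" for Z :: "'a \<Rightarrow> real ^ 'n" and \<omega>
    using measurable_space[OF that] by simp
  have PY: "prob {\<omega> \<in> space \<Omega>. Y \<omega> \<in> {v, - v}} = 1 / N" if v: "v \<in> B" for v
  proof -
    have "{v, - v} \<in> sets sphere_borel" using YD.sets_antipodal[OF unit[OF v]] by simp
    from measure_distr[OF Y this] show ?thesis
      using PB[OF v] by (simp add: vimage_def Int_def conj_commute)
  qed
  obtain \<epsilon> where \<epsilon>: "0 < \<epsilon>" "N * \<epsilon> \<le> 1 / 2" "4 * pi * N * (2 * \<epsilon>) powr (b - 1) \<le> 1"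
    using exists_small_radius[OF b N] by blast
  obtain \<eta> where \<eta>: "0 < \<eta>" and gap: "\<And>x. norm x = 1 \<Longrightarrow> x \<notin> (\<Union>v\<in>B. cell \<epsilon> v) \<Longrightarrow>
      (\<Sum>v\<in>B. clam x v powr b) / N \<le> 1 - 1 / N - \<eta>"
    using potential_gap[OF B b \<epsilon>(1)] unfolding N_def by blast
  define F where "F p = clam (fst p) (snd p) powr b" for p :: "(real ^ 'n) \<times> (real ^ 'n)"
  have "uniformly_continuous_on (sphere 0 1 \<times> sphere 0 1) F"
    unfolding F_def
    by (intro compact_uniformly_continuous compact_Times compact_sphere continuous_on_powr'
        continuous_on_clam continuous_intros) (use b clam_bounds in auto)
  then obtain \<delta>1 where \<delta>1: "0 < \<delta>1" "\<And>p p'. p \<in> sphere 0 1 \<times> sphere 0 1 \<Longrightarrow> p' \<in> sphere 0 1 \<times> sphere 0 1 \<Longrightarrow>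
      dist p' p < \<delta>1 \<Longrightarrow> dist (F p') (F p) < \<eta> / 2"
    using \<eta> unfolding uniformly_continuous_on_def by (metis half_gt_zero)
  \<comment> \<open>Two demands: a displacement below \<delta> changes the kernel by less than
    \<open>\<eta> / 2\<close>, and it moves no point from an axis out of the cell, where a drop of
    \<open>\<epsilon>\<^sup>2 / 2\<close> in the inner product is allowed.\<close>
  define \<delta> where "\<delta> = min \<delta>1 (\<epsilon>\<^sup>2 / 2)"
  have \<delta>: "0 < \<delta>" using \<delta>1(1) \<epsilon>(1) by (simp add: \<delta>_def)
  define E where "E k = {\<omega> \<in> space \<Omega>. \<delta> \<le> norm (X k \<omega> - Y \<omega>)}" for k
  have Eev [measurable]: "E k \<in> events" for k unfolding E_def by measurable
  have "(\<lambda>k. LINT \<omega>|\<Omega>. indicat_real (E k) \<omega>) \<longlonglongrightarrow> (LINT \<omega>|\<Omega>. 0)"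
  proof (rule integral_dominated_convergence[where w = "\<lambda>_. 1"])
    show "AE \<omega> in \<Omega>. (\<lambda>k. indicat_real (E k) \<omega>) \<longlonglongrightarrow> 0"
      using lim
    proof eventually_elim
      case (elim \<omega>)
      have "\<forall>\<^sub>F k in sequentially. norm (X k \<omega> - Y \<omega>) < \<delta>"
        using tendstoD[OF elim \<delta>] by (simp add: dist_norm)
      then have "\<forall>\<^sub>F k in sequentially. indicat_real (E k) \<omega> = 0"
        by eventually_elim (simp add: E_def)
      then show ?case by (rule tendsto_eventually)
    qed
  qed (auto simp: indicator_def)
  then have q0: "(\<lambda>k. prob (E k)) \<longlonglongrightarrow> 0" by simp
  \<comment> \<open>The first bound keeps half of the mass \<open>1 / N\<close> in each cell. The
    second reduces the gap from \<eta> by \<open>\<eta> / 2\<close> and by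
    \<open>\<eta> / 4\<close>, leaving \<open>\<eta> / 4\<close>, and also makes the mass outside
    the cells small compared with that.\<close>
  have "0 < min (1 / (2 * N)) (\<eta> / 4)" using N \<eta> by simp
  from order_tendstoD(2)[OF q0 this] show ?thesis
  proof eventually_elim
    case (elim k)
    then have q: "prob (E k) \<le> 1 / (2 * N)" "prob (E k) \<le> \<eta> / 4" by auto
    interpret XD: sphere_prob "distr \<Omega> sphere_borel (X k)"
      by (intro sphere_probI distr_sphere_probs \<Omega> X)
    have near: "X k \<omega> \<in> cell \<epsilon> v" if "\<omega> \<in> space \<Omega>" "\<omega> \<notin> E k" "v \<in> B" "Y \<omega> \<in> {v, - v}" for \<omega> v
    proof -
      have "\<bar>Y \<omega> \<bullet> v\<bar> = 1" using that(4) unit[OF that(3)] by (auto simp: norm_eq_1)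
      moreover have "\<bar>(X k \<omega> - Y \<omega>) \<bullet> v\<bar> \<le> norm (X k \<omega> - Y \<omega>)"
        using Cauchy_Schwarz_ineq2[of "X k \<omega> - Y \<omega>" v] unit[OF that(3)] by simp
      moreover have "norm (X k \<omega> - Y \<omega>) < \<epsilon>\<^sup>2 / 2" using that(1,2) by (auto simp: E_def \<delta>_def)
      ultimately have "1 - \<epsilon>\<^sup>2 / 2 < \<bar>X k \<omega> \<bullet> v\<bar>" by (simp add: inner_diff_left)
      then show ?thesis using sph[OF X that(1)] by (simp add: cell_def)
    qed
    have mass: "1 / (2 * real CARD('n)) \<le> XD.prob (cell \<epsilon> v)" if v: "v \<in> B" for v
    proof -
      have cs: "cell \<epsilon> v \<in> sets sphere_borel" using XD.cell_events[of \<epsilon> v] by simp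
      have cev: "X k -` cell \<epsilon> v \<inter> space \<Omega> \<in> events" by (rule measurable_sets[OF X cs])
      have "1 / N = prob {\<omega> \<in> space \<Omega>. Y \<omega> \<in> {v, - v}}" using PY[OF v] by simp
      also have "\<dots> \<le> prob ((X k -` cell \<epsilon> v \<inter> space \<Omega>) \<union> E k)"
        using near v cev by (intro finite_measure_mono) (auto intro!: sets.Un)
      also have "\<dots> \<le> prob (X k -` cell \<epsilon> v \<inter> space \<Omega>) + prob (E k)"
        by (rule measure_Un_le[OF cev Eev])
      also have "prob (X k -` cell \<epsilon> v \<inter> space \<Omega>) = XD.prob (cell \<epsilon> v)"
        using measure_distr[OF X cs] by simp
      finally have "1 / N - 1 / (2 * N) \<le> XD.prob (cell \<epsilon> v)" using q(1) by simp
      then show ?thesis using N by (simp add: N_def)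
    qed
    define A where "A = sphere 0 1 - (\<Union>v\<in>B. cell \<epsilon> v)"
    have As: "A \<in> sets sphere_borel"
    proof -
      have "sphere 0 1 \<in> sets sphere_borel" using sets.top[of sphere_borel] by simp
      moreover have "(\<Union>v\<in>B. cell \<epsilon> v) \<in> sets sphere_borel"
        using XD.cell_events o(3) by (intro sets.finite_UN) auto
      ultimately show ?thesis unfolding A_def by (rule sets.Diff)
    qed
    have "XD.prob A = prob (X k -` A \<inter> space \<Omega>)" by (rule measure_distr[OF X As])
    also have "\<dots> \<le> prob (E k)"
    proof (rule finite_measure_mono_AE[OF _ Eev])
      show "AE \<omega> in \<Omega>. \<omega> \<in> X k -` A \<inter> space \<Omega> \<longrightarrow> \<omega> \<in> E k"
        using Yaxes AE_space[of \<Omega>]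
      proof eventually_elim
        case (elim \<omega>)
        then show ?case using near[of \<omega>] by (auto simp: A_def axes_def)
      qed
    qed
    finally have small: "XD.prob (sphere 0 1 - (\<Union>v\<in>B. cell \<epsilon> v)) \<le> 2 * (\<eta> / 4)"
      using q(2) \<eta> by (simp add: A_def)
    have pot: "(LINT y|distr \<Omega> sphere_borel (X k). kpow (ereal a) x y) \<le> 1 - 1 / N - \<eta> / 4"
      if x: "norm x = 1" "x \<notin> (\<Union>v\<in>B. cell \<epsilon> v)" and a: "b \<le> a" for a x
    proof -
      have bd: "\<bar>clam x y powr c\<bar> \<le> 1" if "0 < c" for c and y :: "real ^ 'n"
        using clam_bounds[of x y] that by (auto intro: powr_le1)
      have iY: "integrable \<Omega> (\<lambda>t. clam x (Y t) powr b)"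
        by (rule integrable_const_bound[of _ 1]) (use bd b in auto)
      have iE: "integrable \<Omega> (\<lambda>t. \<eta> / 2 + indicator (E k) t)"
        by (intro Bochner_Integration.integrable_add) (auto simp: integrable_real_indicator emeasure_eq_measure)
      have "(LINT y|distr \<Omega> sphere_borel (X k). kpow (ereal a) x y) = (LINT t|\<Omega>. clam x (X k t) powr a)"
        by (subst integral_distr[OF X]) (auto intro!: sphere_borel_measurable simp: kpow_def)
      also have "\<dots> \<le> (LINT t|\<Omega>. clam x (Y t) powr b + (\<eta> / 2 + indicator (E k) t))"
      proof (rule integral_mono)
        show "integrable \<Omega> (\<lambda>t. clam x (X k t) powr a)"
          by (rule integrable_const_bound[of _ 1]) (use bd b a in auto)
        show "integrable \<Omega> (\<lambda>t. clam x (Y t) powr b + (\<eta> / 2 + indicator (E k) t))"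
          by (intro Bochner_Integration.integrable_add[OF iY iE])
        fix t assume t: "t \<in> space \<Omega>"
        have le: "clam x (X k t) powr a \<le> clam x (X k t) powr b"
          using clam_bounds[of x "X k t"] a b by (cases "clam x (X k t) = 0") (auto intro!: powr_mono')
        show "clam x (X k t) powr a \<le> clam x (Y t) powr b + (\<eta> / 2 + indicator (E k) t)"
        proof (cases "t \<in> E k")
          case True
          then have "indicat_real (E k) t = 1" by simp
          moreover have "0 \<le> clam x (Y t) powr b" by (rule powr_ge_zero)
          moreover have "clam x (X k t) powr b \<le> 1" using bd[of b "X k t"] b by simp
          ultimately show ?thesis using le \<eta> by linarith
        next
          case False
          then have "norm (X k t - Y t) < \<delta>1" using t by (auto simp: E_def \<delta>_def)
          then have "dist (F (x, X k t)) (F (x, Y t)) < \<eta> / 2"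
            using x sph[OF X t] sph[OF Y t] by (intro \<delta>1(2)) (auto simp: dist_Pair_Pair dist_norm)
          then have "clam x (X k t) powr b \<le> clam x (Y t) powr b + \<eta> / 2"
            unfolding F_def dist_real_def fst_conv snd_conv by linarith
          then show ?thesis using le False by simp
        qed
      qed
      also have "\<dots> = (LINT t|\<Omega>. clam x (Y t) powr b) + (\<eta> / 2 + prob (E k))"
      proof -
        have "(LINT t|\<Omega>. \<eta> / 2 + indicator (E k) t) = \<eta> / 2 + prob (E k)"
          by (subst Bochner_Integration.integral_add)
            (auto simp: integrable_real_indicator emeasure_eq_measure prob_space)
        then show ?thesis by (subst Bochner_Integration.integral_add[OF iY iE]) simp
      qed
      also have "(LINT t|\<Omega>. clam x (Y t) powr b) = (\<Sum>v\<in>B. clam x v powr b) / N"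
      proof -
        have Yev: "{\<omega> \<in> space \<Omega>. Y \<omega> \<in> {v, - v}} \<in> events" for v by measurable
        have ind: "indicat_real {\<omega> \<in> space \<Omega>. Y \<omega> \<in> {v, - v}} t = indicator {v, - v} (Y t)" if "t \<in> space \<Omega>" for v t
          using that by (auto simp: indicator_def)
        have "(LINT t|\<Omega>. clam x (Y t) powr b) =
            (LINT t|\<Omega>. (\<Sum>v\<in>B. indicat_real {\<omega> \<in> space \<Omega>. Y \<omega> \<in> {v, - v}} t * (clam x v powr b)))"
        proof (rule integral_cong_AE)
          show "AE t in \<Omega>. clam x (Y t) powr b =
              (\<Sum>v\<in>B. indicat_real {\<omega> \<in> space \<Omega>. Y \<omega> \<in> {v, - v}} t * (clam x v powr b))"
            using Yaxes AE_space[of \<Omega>]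
          proof eventually_elim
            case (elim t)
            show ?case
              using sum_indicator_axes[OF o(1) elim(1), of "\<lambda>v. clam x v powr b"] ind[OF elim(2)] by simp
          qed
          show "(\<lambda>t. \<Sum>v\<in>B. indicat_real {\<omega> \<in> space \<Omega>. Y \<omega> \<in> {v, - v}} t * (clam x v powr b)) \<in> borel_measurable \<Omega>"
            using Yev by (intro borel_measurable_sum borel_measurable_times borel_measurable_const
                borel_measurable_indicator)
        qed measurable
        also have "\<dots> = (\<Sum>v\<in>B. LINT t|\<Omega>. indicat_real {\<omega> \<in> space \<Omega>. Y \<omega> \<in> {v, - v}} t * (clam x v powr b))"
          by (rule Bochner_Integration.integral_sum, rule integrable_mult_left)
            (use Yev in \<open>simp add: integrable_real_indicator emeasure_eq_measure\<close>)
        also have "\<dots> = (\<Sum>v\<in>B. 1 / N * (clam x v powr b))"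
        proof (rule sum.cong[OF refl])
          fix v assume "v \<in> B"
          then show "(LINT t|\<Omega>. indicat_real {\<omega> \<in> space \<Omega>. Y \<omega> \<in> {v, - v}} t * (clam x v powr b))
              = 1 / N * (clam x v powr b)"
            using PY Yev[of v] by (subst integral_mult_left_zero) simp
        qed
        finally show ?thesis by (simp add: sum_divide_distrib)
      qed
      finally show ?thesis using gap[OF x] q(2) by simp
    qed
    show ?case
    proof (intro allI impI)
      fix a assume a: "b \<le> a"
      \<comment> \<open>A base of at most 1 makes the radius condition for b imply the one for any
        larger exponent.\<close>
      have "2 * \<epsilon> \<le> 1"
      proof -
        have "1 * \<epsilon> \<le> N * \<epsilon>" using N \<epsilon>(1) by (intro mult_right_mono) auto
        then show ?thesis using \<epsilon>(2) by linarith
      qed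
      then have "(2 * \<epsilon>) powr (a - 1) \<le> (2 * \<epsilon>) powr (b - 1)"
        using \<epsilon>(1) a by (intro powr_mono') auto
      then have "4 * pi * N * (2 * \<epsilon>) powr (a - 1) \<le> 4 * pi * N * (2 * \<epsilon>) powr (b - 1)"
        using N by (intro mult_left_mono) auto
      then have "4 * pi * real CARD('n) * (2 * \<epsilon>) powr (a - 1) \<le> 1"
        using \<epsilon>(3) unfolding N_def by (rule order_trans)
      then show "energy (ereal a) (distr \<Omega> sphere_borel (X k)) \<le> 1 / 2 * (1 - 1 / real CARD('n))"
        using XD.energy_le_near_axes[OF B _ \<epsilon>(1) _ _ mass small] \<epsilon>(2) pot[OF _ _ a] a b
        by (simp add: N_def)
    qed
  qed
qed

section \<open>Strict inclusion at the threshold\<close>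

theorem theorem3p6:
  fixes d :: nat
  assumes "d \<ge> 1"
    and "CARD('n::finite) = d + 1"
    and "threshold_exponent TYPE('n) < \<infinity>"
  shows "(P_Delta_eq :: (real ^ 'n) measure set) \<subset> energy_argmax (threshold_exponent TYPE('n))"
proof -
  \<comment> \<open>The factor 1/2 is included here: \<open>D\<close> is the common energy of the
    measures in \<open>P_Delta_eq\<close>.\<close>
  define D where "D = 1 / 2 * (1 - 1 / real CARD('n))"
  have N: "CARD('n) \<ge> 2" using assms by simp
  have Inf: "threshold_exponent TYPE('n) = Inf (delta_exponents TYPE('n))"
    by (rule threshold_exponent_eq_Inf[OF N])
  have "1 \<le> Inf (delta_exponents TYPE('n))"
    using delta_exponents_ge_1[OF N] by (rule Inf_greatest)
  then obtain a where a: "Inf (delta_exponents TYPE('n)) = ereal a"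
    using assms(3) Inf by (cases "Inf (delta_exponents TYPE('n))") auto
  note mem = Inf_delta_exponents_mem[OF N a]
  have bound: "energy (ereal a) \<nu> \<le> D" if "\<nu> \<in> sphere_probs" for \<nu> :: "(real ^ 'n) measure"
    using mem(1) that by (simp add: delta_exponents_def D_def)
  have argmaxI: "\<mu> \<in> energy_argmax (ereal a)" if "\<mu> \<in> sphere_probs" "D \<le> energy (ereal a) \<mu>"
    for \<mu> :: "(real ^ 'n) measure"
    using that bound unfolding energy_argmax_def is_arg_max_def by (auto simp: not_less intro: order_trans)
  have "\<exists>\<mu> :: (real ^ 'n) measure. \<mu> \<in> energy_argmax (ereal a) \<and> \<mu> \<notin> P_Delta_eq"
  proof (cases "a = 1")
    case True
    obtain \<mu> :: "(real ^ 'n) measure" where \<mu>: "\<mu> \<in> sphere_probs - P_Delta_eq" and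
      E: "\<And>\<alpha>. \<alpha> > 0 \<Longrightarrow> energy (ereal \<alpha>) \<mu> =
        1 / 2 * (1 - 1 / real CARD('n) + (2 powr (1 - \<alpha>) - 1) / (real CARD('n))\<^sup>2)"
      using exists_mixture_of_bases[OF N] by blast
    \<comment> \<open>At exponent 1 the excess \<open>2 powr (1 - 1) - 1\<close> of the mixture
      vanishes.\<close>
    have "energy (ereal a) \<mu> = D" using E[of a] True by (simp add: D_def)
    then show ?thesis using \<mu> argmaxI[of \<mu>] by auto
  next
    case False
    then have a1: "1 < a" using mem(2) by simp
    \<comment> \<open>These exponents stay strictly below a, where the bound fails, and above the
      midpoint of 1 and a, where the estimate near \<open>P_Delta_eq\<close> is uniform.\<close>
    define c where "c k = a - (a - 1) / 2 * inverse (real (Suc k))" for k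
    have c_lim: "c \<longlonglongrightarrow> a"
    proof -
      have "(\<lambda>k. a - (a - 1) / 2 * inverse (real (Suc k))) \<longlonglongrightarrow> a - (a - 1) / 2 * 0"
        by (intro tendsto_intros LIMSEQ_inverse_real_of_nat)
      then show ?thesis by (simp add: c_def[abs_def])
    qed
    have c_less: "c k < a" for k using a1 by (simp add: c_def)
    have c_ge: "(1 + a) / 2 \<le> c k" for k
    proof -
      have "(a - 1) / 2 * inverse (real (Suc k)) \<le> (a - 1) / 2 * 1"
        using a1 by (intro mult_left_mono) (auto simp: field_simps)
      then show ?thesis by (simp add: c_def field_simps)
    qed
    have "\<exists>\<mu> :: (real ^ 'n) measure. \<mu> \<in> sphere_probs \<and> D < energy (ereal (c k)) \<mu>" for k
    proof -
      have "ereal (c k) \<notin> delta_exponents TYPE('n)"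
        using Inf_lower[of "ereal (c k)" "delta_exponents TYPE('n)"] a c_less[of k] by auto
      moreover have "0 < c k" using c_ge[of k] a1 by simp
      ultimately show ?thesis by (auto simp: delta_exponents_def D_def not_le)
    qed
    then obtain \<mu> :: "nat \<Rightarrow> (real ^ 'n) measure" where
      \<mu>: "\<And>k. \<mu> k \<in> sphere_probs" "\<And>k. D < energy (ereal (c k)) (\<mu> k)" by metis
    obtain r and \<Omega> :: "real measure" and X Y where r: "strict_mono r" and \<Omega>: "prob_space \<Omega>"
      and X: "\<And>k. X k \<in> \<Omega> \<rightarrow>\<^sub>M sphere_borel" "\<And>k. distr \<Omega> sphere_borel (X k) = \<mu> (r k)"
      and Y: "Y \<in> \<Omega> \<rightarrow>\<^sub>M sphere_borel" and lim: "AE \<omega> in \<Omega>. (\<lambda>k. X k \<omega>) \<longlonglongrightarrow> Y \<omega>"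
      using sphere_probs_subsequence_coupling[of \<mu>, OF \<mu>(1)] by blast
    let ?\<nu> = "distr \<Omega> sphere_borel Y"
    have cr: "(\<lambda>k. c (r k)) \<longlonglongrightarrow> a" using LIMSEQ_subseq_LIMSEQ[OF c_lim r] by (simp add: comp_def)
    have c_pos: "0 < c (r k)" for k using c_ge[of "r k"] a1 by simp
    have "(\<lambda>k. energy (ereal (c (r k))) (distr \<Omega> sphere_borel (X k))) \<longlonglongrightarrow> energy (ereal a) ?\<nu>"
      using a1 by (intro tendsto_energy[OF \<Omega> X(1) Y lim c_pos cr]) simp
    then have "D \<le> energy (ereal a) ?\<nu>"
      by (rule LIMSEQ_le_const) (use \<mu>(2) X(2) in \<open>auto intro: less_imp_le\<close>)
    then have "?\<nu> \<in> energy_argmax (ereal a)"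
      by (intro argmaxI distr_sphere_probs \<Omega> Y)
    moreover have "?\<nu> \<notin> P_Delta_eq"
    proof
      assume P: "?\<nu> \<in> P_Delta_eq"
      have "1 < (1 + a) / 2" using a1 by simp
      from eventually_energy_le_near_P_Delta_eq[OF \<Omega> X(1) Y lim P this]
      obtain k where "\<And>\<alpha>. (1 + a) / 2 \<le> \<alpha> \<Longrightarrow> energy (ereal \<alpha>) (distr \<Omega> sphere_borel (X k)) \<le> D"
        unfolding D_def by (auto simp: eventually_sequentially)
      from this[OF c_ge[of "r k"]] show False using \<mu>(2)[of "r k"] X(2)[of k] by simp
    qed
    ultimately show ?thesis by blast
  qed
  moreover have "(P_Delta_eq :: (real ^ 'n) measure set) \<subseteq> energy_argmax (ereal a)"
    by (rule P_Delta_eq_subset_argmax[OF mem(1)])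
  ultimately show ?thesis unfolding Inf a by blast
qed

end
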